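(* Let $M$ be a multiline queue, $\alpha=\mathrm{type}(M)$ and $\beta=\mathrm{type}(\rho_N(M))$. For $i<j$, \[ \alpha_i<\alpha_j\implies \beta_i<\beta_j . \]
   Context: Fix $n$. For a partition $\lambda$ with $L=\lambda_1$, $n>\ell(\lambda)$, a multiline queue (MLQ) of shape $\lambda$ is a tuple $M=(B_1,\dots,B_L)$ of subsets of $[n]$ with $|B_r|=\lambda'_r$, pictured as an $L\times n$ array, rows $1..L$ bottom to top, columns $1..n$ left to right cyclically, ball at $(r,j)$ iff $j\in B_r$. FM labelling: for $r=L,\dots,2$: unlabelled balls of row $r$ get label $r$; then balls of row $r$ in order of decreasing label (left to right among equals) are each paired with the first not-yet-paired ball of row $r-1$ weakly to the right (cyclically), which receives the same label. Remaining balls of row 1 get label 1. $\mathrm{type}(M)$ is the length-$n$ sequence of row-1 labels (0 at empty sites). Bracketing w.r.t. $j$: in a word, $j\mapsto$ ")", $j+1\mapsto$ "(", other letters ignored; iteratively match a "(" with a ")" to its right when no unmatched parenthesis is between them. For a tuple $N$ of subsets of $[n]$, $cw(N)$ lists the row indices of the balls, columns left to right, each column top to bottom. $e^{\downarrow}_j(N)$ moves the ball of the leftmost unmatched $j+1$ of $cw(N)$ from row $j+1$ to row $j$ in the same column (identity if none); $e^{\downarrow\star}_j$ applies $e^{\downarrow}_j$ until it acts trivially. The collapsing map is $\rho_N(M)=e^{\downarrow\star}_{[L-1,1]}\cdots e^{\downarrow\star}_{[2,1]}e^{\downarrow\star}_{[1,1]}(M)$ with $e^{\downarrow\star}_{[b,1]}=e^{\downarrow\star}_1e^{\downarrow\star}_2\cdots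 e^{\downarrow\star}_b$ (operators applied right to left); $\rho_N(M)$ is again a multiline queue on $n$ columns. *)

theory Defs
  imports Main "HOL-Library.While_Combinator"
begin

text \<open>A partition is the weakly decreasing list of its positive parts, so its number of parts
  is the length of the list.\<close>

definition is_partition :: "nat list \<Rightarrow> bool" where
  "is_partition lam \<longleftrightarrow> sorted_wrt (\<ge>) lam \<and> 0 \<notin> set lam"

definition largest_part :: "nat list \<Rightarrow> nat" where
  "largest_part lam = (case lam of [] \<Rightarrow> 0 | p # _ \<Rightarrow> p)"

definition conj_part :: "nat list \<Rightarrow> nat \<Rightarrow> nat" where
  "conj_part lam r = card {i. i < length lam \<and> r \<le> lam ! i}"

text \<open>A tuple \<open>(B\<^sub>1, \<dots>, B\<^sub>L)\<close> of rows is a list, bottom row first; rows and columns are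
  numbered from 1.\<close>

definition row :: "nat set list \<Rightarrow> nat \<Rightarrow> nat set" where
  "row N r = N ! (r - 1)"

definition is_mlq :: "nat \<Rightarrow> nat list \<Rightarrow> nat set list \<Rightarrow> bool" where
  "is_mlq n lam M \<longleftrightarrow>
     length M = largest_part lam \<and>
     (\<forall>r \<in> {1..length M}. row M r \<subseteq> {1..n} \<and> card (row M r) = conj_part lam r)"


subsection \<open>Ferrari--Martin labelling and type\<close>

text \<open>The labels of a row form a function on columns; 0 stands for an empty site or a ball not
  yet labelled. This is unambiguous because all labels are at least 1.\<close>

definition first_unpaired :: "nat \<Rightarrow> nat set \<Rightarrow> (nat \<Rightarrow> nat) \<Rightarrow> nat \<Rightarrow> nat option" where
  "first_unpaired n B g c = find (\<lambda>d. d \<in> B \<and> g d = 0) ([c..<Suc n] @ [1..<c])"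

definition pair_ball ::
  "nat \<Rightarrow> nat set \<Rightarrow> (nat \<Rightarrow> nat) \<Rightarrow> nat \<Rightarrow> (nat \<Rightarrow> nat) \<Rightarrow> (nat \<Rightarrow> nat)" where
  "pair_ball n B f c g =
     (case first_unpaired n B g c of None \<Rightarrow> g | Some d \<Rightarrow> g(d := f c))"

text \<open>\<open>sort_key\<close> is stable, so balls with equal labels stay in left-to-right order.\<close>

definition pairing_order :: "nat \<Rightarrow> (nat \<Rightarrow> nat) \<Rightarrow> nat list" where
  "pairing_order n f = sort_key (\<lambda>c. - int (f c)) (filter (\<lambda>c. f c \<noteq> 0) [1..<Suc n])"

text \<open>Labels passed down to the row \<open>B\<close> from the row above it, which is labelled by \<open>f\<close>.\<close>

definition pair_rows :: "nat \<Rightarrow> nat set \<Rightarrow> (nat \<Rightarrow> nat) \<Rightarrow> (nat \<Rightarrow> nat)" where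
  "pair_rows n B f = fold (pair_ball n B f) (pairing_order n f) (\<lambda>_. 0)"

definition label_rest :: "nat \<Rightarrow> nat set \<Rightarrow> (nat \<Rightarrow> nat) \<Rightarrow> (nat \<Rightarrow> nat)" where
  "label_rest r B g = (\<lambda>c. if c \<in> B \<and> g c = 0 then r else g c)"

text \<open>\<open>fm_labels n r Bs\<close> are the labels of row \<open>r\<close>, where \<open>Bs\<close> lists the rows
  \<open>r, r + 1, \<dots>, L\<close>. There is nothing above row \<open>L\<close>, which thus only receives the label \<open>L\<close>.\<close>

fun fm_labels :: "nat \<Rightarrow> nat \<Rightarrow> nat set list \<Rightarrow> (nat \<Rightarrow> nat)" where
  "fm_labels n r [] = (\<lambda>_. 0)"
| "fm_labels n r (B # Bs) = label_rest r B (pair_rows n B (fm_labels n (Suc r) Bs))"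

definition mlq_type :: "nat \<Rightarrow> nat set list \<Rightarrow> nat list" where
  "mlq_type n M = map (fm_labels n 1 M) [1..<Suc n]"


subsection \<open>Bracketing, lowering operators and the collapsing map\<close>

text \<open>\<open>matched w j p q\<close>: the opening parenthesis (a letter \<open>j + 1\<close>) at position \<open>p\<close> of \<open>w\<close> is
  matched with the closing one (a letter \<open>j\<close>) at position \<open>q\<close>. A parenthesis strictly between
  has to be matched beforehand, while \<open>p\<close> and \<open>q\<close> are still free. Its partner then also lies
  strictly between them: otherwise \<open>p\<close> or \<open>q\<close> would be an unmatched parenthesis between the two
  partners.\<close>

inductive matched :: "nat list \<Rightarrow> nat \<Rightarrow> nat \<Rightarrow> nat \<Rightarrow> bool" for w j where
  "\<lbrakk> p < q; q < length w; w ! p = Suc j; w ! q = j;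
     \<forall>k \<in> {p<..<q}. w ! k \<in> {j, Suc j} \<longrightarrow>
       (\<exists>k' \<in> {p<..<q}. matched w j k k' \<or> matched w j k' k) \<rbrakk>
   \<Longrightarrow> matched w j p q"

definition unmatched_open :: "nat list \<Rightarrow> nat \<Rightarrow> nat \<Rightarrow> bool" where
  "unmatched_open w j p \<longleftrightarrow> p < length w \<and> w ! p = Suc j \<and> (\<nexists>q. matched w j p q)"

text \<open>The balls, as pairs (row, column), in the reading order of the column word.\<close>

definition ball_seq :: "nat \<Rightarrow> nat set list \<Rightarrow> (nat \<times> nat) list" where
  "ball_seq n N =
     [(r, c). c \<leftarrow> [1..<Suc n], r \<leftarrow> rev [1..<Suc (length N)], c \<in> row N r]"

definition cw :: "nat \<Rightarrow> nat set list \<Rightarrow> nat list" where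
  "cw n N = map fst (ball_seq n N)"

definition move_down :: "nat \<Rightarrow> nat \<Rightarrow> nat set list \<Rightarrow> nat set list" where
  "move_down j c N = N[j := row N (Suc j) - {c}, j - 1 := insert c (row N j)]"

definition e_down :: "nat \<Rightarrow> nat \<Rightarrow> nat set list \<Rightarrow> nat set list" where
  "e_down n j N =
     (if \<exists>p. unmatched_open (cw n N) j p
      then move_down j (snd (ball_seq n N ! (LEAST p. unmatched_open (cw n N) j p))) N
      else N)"

definition e_down_star :: "nat \<Rightarrow> nat \<Rightarrow> nat set list \<Rightarrow> nat set list" where
  "e_down_star n j = while (\<lambda>N. e_down n j N \<noteq> N) (e_down n j)"

text \<open>The operator with index \<open>[b, 1]\<close>: \<open>foldr\<close> applies \<open>e_down_star n b\<close> first and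
  \<open>e_down_star n 1\<close> last.\<close>

definition e_down_star_upto :: "nat \<Rightarrow> nat \<Rightarrow> nat set list \<Rightarrow> nat set list" where
  "e_down_star_upto n b N = foldr (e_down_star n) [1..<Suc b] N"

text \<open>\<open>fold\<close> applies index \<open>[1, 1]\<close> first and \<open>[L - 1, 1]\<close> last, where \<open>L = length M\<close>. The number
  of rows is kept, so the topmost rows of the result may be empty; these contribute no labels.\<close>

definition collapse :: "nat \<Rightarrow> nat set list \<Rightarrow> nat set list" where
  "collapse n M = fold (e_down_star_upto n) [1..<length M] M"

end

theory Submission
  imports Defs
begin

text \<open>Write \<open>D\<^sub>k\<close> for the set of columns whose label in \<open>M\<close> is at least \<open>k\<close>, and \<open>E\<^sub>k\<close> for the same set in
  the collapsed queue \<open>N\<close>. It suffices to find, for each \<open>j \<in> D\<^sub>k\<close>, some \<open>E\<^sub>l\<close> that contains \<open>j\<close> and whose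
  part left of \<open>j\<close> lies in \<open>D\<^sub>k\<close>.

  The set \<open>D\<^sub>k\<close> is the bottom row of a tuple obtained from \<open>M\<close> by row exchanges, each of which moves along
  a string of the row crystal. The collapse depends only on the component of that crystal, because
  a component contains just one nonwrapping tuple; this is shown with the commuting
  crystal operators on columns. So \<open>N\<close> arises by inserting the bottom row \<open>D\<^sub>k\<close> below a nonwrapping
  tuple, and there the sets \<open>E\<^sub>l\<close> can be compared with \<open>D\<^sub>k\<close> by induction on the number of rows.\<close>

text \<open>Labels come from a cyclic pairing, whereas the collapse is built from linear bracketing,
  and its operators come in an order unrelated to that of the labelling. Three facts bridge this.
  Larger labels are paired first, so the labels \<open>>= k\<close> of a row depend only on the
  labels \<open>>= k\<close> of the row above, and each threshold leaves a pairing of plain sets.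
  That pairing, wrapping balls included, is a row exchange which one lowering operator cannot
  distinguish from the original pair of rows. And since the nonwrapping result does not depend on
  the chosen operators, the upper rows may be collapsed first and the bottom row inserted last.

  The containment asked for is one-sided because this is all an inequality needs: for
  \<open>k\<close> the label of \<open>j\<close> in \<open>M\<close>, the smaller label of
  \<open>i\<close> puts \<open>i\<close> outside \<open>D_k\<close>, hence outside the chosen
  \<open>E_l\<close>, which contains \<open>j\<close>. The index \<open>l\<close> may vary with
  \<open>j\<close> and \<open>k\<close>, so no correspondence between old and new labels has to be
  described.\<close>

section \<open>Bracketing by scanning from the right\<close>

text \<open>The number of closing parentheses still waiting for a partner when a word is read
  from right to left.\<close>

primrec scan :: "nat \<Rightarrow> nat list \<Rightarrow> nat" where
  "scan j [] = 0"
| "scan j (x # xs) =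
     (if x = j then Suc (scan j xs) else if x = Suc j then scan j xs - 1 else scan j xs)"

lemma scan_drop:
  assumes "x < length w"
  shows "scan j (drop x w) =
    (if w ! x = j then Suc (scan j (drop (Suc x) w))
     else if w ! x = Suc j then scan j (drop (Suc x) w) - 1 else scan j (drop (Suc x) w))"
  using Cons_nth_drop_Suc[OF assms, symmetric] by (metis scan.simps(2))

text \<open>Path form of bracketing. The count of waiting closers is a height, read from the right:
  \<open>q\<close> raises it, and \<open>p\<close> is the first position to the left of
  \<open>q\<close> that undoes this step. The truncation in \<open>scan\<close> is harmless here, as
  the height just after \<open>p\<close> is positive.\<close>

definition scan_matched :: "nat list \<Rightarrow> nat \<Rightarrow> nat \<Rightarrow> nat \<Rightarrow> bool" where
  "scan_matched w j p q \<longleftrightarrow>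
     p < q \<and> q < length w \<and> w ! p = Suc j \<and> w ! q = j \<and>
     scan j (drop (Suc p) w) = scan j (drop q w) \<and>
     (\<forall>k \<in> {p<..q}. scan j (drop q w) \<le> scan j (drop k w))"

text \<open>If the path dipped below its height at \<open>q\<close>, or had not come back to it at
  \<open>Suc p\<close>, take an extremal offending position. It sits at a parenthesis, whose partner
  inside the interval leads, by the induction hypothesis, to a more extreme one.\<close>

lemma matched_imp_scan_matched:
  assumes "matched w j p q"
  shows "scan_matched w j p q"
  using assms
proof (induction rule: matched.induct)
  case (1 p q)
  let ?D = "\<lambda>x. scan j (drop x w)"
  have Dq: "?D q = Suc (?D (Suc q))" using scan_drop[OF 1(2), of j] 1(4) by simp
  have low: "?D q \<le> ?D k" if "k \<in> {p<..q}" for k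
  proof (rule ccontr)
    assume neg: "\<not> ?D q \<le> ?D k"
    define P where "P = (\<lambda>k. p < k \<and> k \<le> q \<and> ?D k < ?D q)"
    have Pk: "P k" using that neg by (simp add: P_def)
    have bd: "\<And>y. P y \<Longrightarrow> y \<le> q" by (simp add: P_def)
    define g where "g = Greatest P"
    have Pg: "P g" unfolding g_def by (rule GreatestI_nat[of P, OF Pk bd])
    have gmax: "\<And>y. P y \<Longrightarrow> y \<le> g" unfolding g_def using Greatest_le_nat[of P _ q] bd by blast
    have gq: "g < q" "p < g" using Pg by (auto simp: P_def order.strict_iff_order)
    have up: "?D q \<le> ?D x" if "g < x" "x \<le> q" for x
      using gmax[of x] that gq by (fastforce simp: P_def)
    have "?D q \<le> ?D (Suc g)" using up gq by simp
    moreover have "?D g < ?D q" using Pg by (simp add: P_def)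
    ultimately have wg: "w ! g = Suc j" and Dg: "?D (Suc g) = ?D q"
      using scan_drop[of g w j] gq 1(2) by (auto split: if_splits)
    obtain k' where k': "k' \<in> {p<..<q}" "scan_matched w j g k' \<or> scan_matched w j k' g"
      using 1(5) gq wg by fastforce
    then have m: "scan_matched w j g k'" using wg by (auto simp: scan_matched_def)
    then have "?D k' = Suc (?D (Suc k'))" "?D (Suc g) = ?D k'" "g < k'"
      using scan_drop[of k' w j] by (auto simp: scan_matched_def)
    then show False using up[of "Suc k'"] k'(1) Dg by simp
  qed
  have "?D (Suc p) \<le> ?D q"
  proof (rule ccontr)
    assume neg: "\<not> ?D (Suc p) \<le> ?D q"
    define P where "P = (\<lambda>x. p < x \<and> x \<le> q \<and> ?D x \<le> ?D q)"
    define l where "l = Least P"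
    have Pl: "P l" unfolding l_def by (rule LeastI[of P q]) (use 1(1) in \<open>simp add: P_def\<close>)
    have lmin: "\<And>y. P y \<Longrightarrow> l \<le> y" unfolding l_def by (rule Least_le)
    have "l \<noteq> Suc p" using Pl neg by (auto simp: P_def)
    then have lp: "Suc p < l" "l \<le> q" using Pl by (auto simp: P_def)
    then obtain y where y: "l = Suc y" by (cases l) auto
    have yb: "p < y" "y < q" using lp y by auto
    have "?D q < ?D y" using lmin[of y] y yb by (fastforce simp: P_def)
    moreover have "?D l \<le> ?D q" using Pl by (simp add: P_def)
    ultimately have wy: "w ! y = j" using scan_drop[of y w j] yb 1(2) y by (auto split: if_splits)
    then have Dy: "?D y = Suc (?D l)" using scan_drop[of y w j] yb 1(2) y by auto
    obtain k' where k': "k' \<in> {p<..<q}" "scan_matched w j y k' \<or> scan_matched w j k' y"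
      using 1(5) yb wy by fastforce
    then have m: "scan_matched w j k' y" using wy by (auto simp: scan_matched_def)
    then have "?D (Suc k') = ?D y" "w ! k' = Suc j" "k' < y" by (auto simp: scan_matched_def)
    then have "?D k' = ?D l" using scan_drop[of k' w j] yb 1(2) Dy by auto
    then have "P k'" using k'(1) Pl by (auto simp: P_def)
    then show False using lmin[of k'] \<open>k' < y\<close> y by simp
  qed
  then have "?D (Suc p) = ?D q" using low[of "Suc p"] 1(1) by simp
  then show ?case using 1(1-4) low by (auto simp: scan_matched_def)
qed

text \<open>Every parenthesis inside the interval needs an inner partner. For an opener this is the
  letter at which the height first falls below its level on the right; for a closer, the nearest
  position on the left where the height is lower. The bound on the heights keeps both
  inside.\<close>

lemma scan_matched_imp_matched: "scan_matched w j p q \<Longrightarrow> matched w j p q"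
proof (induction "q - p" arbitrary: p q rule: less_induct)
  case less
  let ?D = "\<lambda>x. scan j (drop x w)"
  have pq: "p < q" "q < length w" "w ! p = Suc j" "w ! q = j" and Dp: "?D (Suc p) = ?D q"
    and low: "\<And>k. p < k \<Longrightarrow> k \<le> q \<Longrightarrow> ?D q \<le> ?D k"
    using less(2) by (auto simp: scan_matched_def)
  have Dq: "?D q = Suc (?D (Suc q))" using scan_drop[OF pq(2), of j] pq(4) by simp
  have "\<exists>k' \<in> {p<..<q}. matched w j k k' \<or> matched w j k' k"
    if k: "k \<in> {p<..<q}" and wk: "w ! k \<in> {j, Suc j}" for k
  proof -
    have kl: "k < length w" "p < k" "k < q" using k pq by auto
    show ?thesis
    proof (cases "w ! k = Suc j")
      case True
      have Dk: "?D (Suc k) = Suc (?D k)" "?D q \<le> ?D k"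
        using low[of k] kl scan_drop[of k w j] True Dq by auto
      define P where "P = (\<lambda>x. k < x \<and> x \<le> q \<and> ?D x < ?D (Suc k))"
      define l where "l = Least P"
      have Pl: "P l" unfolding l_def by (rule LeastI[of P q]) (use kl Dk in \<open>simp add: P_def\<close>)
      have lmin: "\<And>y. P y \<Longrightarrow> l \<le> y" unfolding l_def by (rule Least_le)
      have "l \<noteq> Suc k" using Pl by (auto simp: P_def)
      then have lk: "Suc k < l" "l \<le> q" using Pl by (auto simp: P_def)
      then obtain y where y: "l = Suc y" by (cases l) auto
      have yb: "k < y" "y < q" using lk y by auto
      have ge: "?D (Suc k) \<le> ?D x" if "k < x" "x \<le> y" for x
        using lmin[of x] that y yb by (fastforce simp: P_def)
      have "?D l < ?D (Suc k)" using Pl by (simp add: P_def)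
      then have "w ! y = j" "?D y = ?D (Suc k)"
        using ge[of y] yb scan_drop[of y w j] pq(2) y by (auto split: if_splits)
      then have "scan_matched w j k y" using True yb pq ge by (auto simp: scan_matched_def)
      then have "matched w j k y" using less(1)[of y k] yb kl by auto
      then show ?thesis using yb kl by auto
    next
      case False
      then have wk: "w ! k = j" using wk by simp
      have Dk: "?D k = Suc (?D (Suc k))" "?D q \<le> ?D (Suc k)"
        using low[of "Suc k"] kl scan_drop[of k w j] wk by auto
      define P where "P = (\<lambda>x. p < x \<and> x \<le> k \<and> ?D x < ?D k)"
      have Pp: "P (Suc p)" using kl Dk Dp by (simp add: P_def)
      have bd: "\<And>y. P y \<Longrightarrow> y \<le> k" by (simp add: P_def)
      define g where "g = Greatest P"
      have Pg: "P g" unfolding g_def by (rule GreatestI_nat[of P, OF Pp bd])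
      have gmax: "\<And>y. P y \<Longrightarrow> y \<le> g" unfolding g_def using Greatest_le_nat[of P _ k] bd by blast
      have gk: "g < k" "p < g" "?D g < ?D k" using Pg by (auto simp: P_def order.strict_iff_order)
      have ge: "?D k \<le> ?D x" if "g < x" "x \<le> k" for x
        using gmax[of x] that gk by (fastforce simp: P_def)
      have "w ! g = Suc j" "?D (Suc g) = ?D k"
        using ge[of "Suc g"] gk kl scan_drop[of g w j] by (auto split: if_splits)
      then have "scan_matched w j g k" using wk kl gk ge by (auto simp: scan_matched_def)
      then have "matched w j g k" using less(1)[of k g] gk kl by auto
      then show ?thesis using gk kl by auto
    qed
  qed
  then show ?case using pq by (intro matched.intros) auto
qed

lemma unmatched_open_iff_scan:
  "unmatched_open w j p \<longleftrightarrow> p < length w \<and> w ! p = Suc j \<and> scan j (drop (Suc p) w) = 0"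
proof -
  let ?D = "\<lambda>x. scan j (drop x w)"
  have "(\<exists>q. matched w j p q) \<longleftrightarrow> 0 < ?D (Suc p)" if p: "p < length w" "w ! p = Suc j"
  proof
    assume "\<exists>q. matched w j p q"
    then obtain q where "scan_matched w j p q" using matched_imp_scan_matched by blast
    then show "0 < ?D (Suc p)" using scan_drop[of q w j] by (auto simp: scan_matched_def)
  next
    assume pos: "0 < ?D (Suc p)"
    define P where "P = (\<lambda>x. p < x \<and> x \<le> length w \<and> ?D x < ?D (Suc p))"
    define l where "l = Least P"
    have Pl: "P l" unfolding l_def
      by (rule LeastI[of P "length w"]) (use p pos in \<open>simp add: P_def\<close>)
    have lmin: "\<And>y. P y \<Longrightarrow> l \<le> y" unfolding l_def by (rule Least_le)
    have "l \<noteq> Suc p" using Pl by (auto simp: P_def)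
    then have lk: "Suc p < l" "l \<le> length w" using Pl by (auto simp: P_def)
    then obtain y where y: "l = Suc y" by (cases l) auto
    have yb: "p < y" "y < length w" using lk y by auto
    have ge: "?D (Suc p) \<le> ?D x" if "p < x" "x \<le> y" for x
      using lmin[of x] that y yb by (fastforce simp: P_def)
    have "?D l < ?D (Suc p)" using Pl by (simp add: P_def)
    then have "w ! y = j" "?D y = ?D (Suc p)"
      using ge[of y] yb scan_drop[of y w j] y by (auto split: if_splits)
    then have "scan_matched w j p y" using p yb ge by (auto simp: scan_matched_def)
    then show "\<exists>q. matched w j p q" using scan_matched_imp_matched by blast
  qed
  then show ?thesis unfolding unmatched_open_def by auto
qed


section \<open>Lowering operators on pairs of rows\<close>

text \<open>\<open>pend n A B c\<close> is the column version of \<^const>\<open>scan\<close> for a lower row \<open>A\<close> and an upper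
  row \<open>B\<close>: the balls of \<open>A\<close> in the columns \<open>c + 1, \<dots>, n\<close> that are free for balls of \<open>B\<close> in the columns
  up to \<open>c\<close>. Truncated subtraction discards the unmatched opening parentheses.\<close>

primrec pend_aux :: "nat \<Rightarrow> nat set \<Rightarrow> nat set \<Rightarrow> nat \<Rightarrow> nat" where
  "pend_aux n A B 0 = 0"
| "pend_aux n A B (Suc t) = pend_aux n A B t + of_bool (n - t \<in> A) - of_bool (n - t \<in> B)"

definition pend :: "nat \<Rightarrow> nat set \<Rightarrow> nat set \<Rightarrow> nat \<Rightarrow> nat" where
  "pend n A B c = pend_aux n A B (n - c)"

lemma pend_top [simp]: "pend n A B n = 0"
  by (simp add: pend_def)

lemma pend_step:
  assumes "c < n"
  shows "pend n A B c = pend n A B (Suc c) + of_bool (Suc c \<in> A) - of_bool (Suc c \<in> B)"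
proof -
  have "n - c = Suc (n - Suc c)" "n - (n - Suc c) = Suc c" using assms by auto
  then show ?thesis unfolding pend_def by simp
qed

lemma pend_cong:
  assumes "c \<le> d" "d \<le> n" "pend n A B d = pend n A' B' d"
    and "\<And>x. c < x \<Longrightarrow> x \<le> d \<Longrightarrow> (x \<in> A \<longleftrightarrow> x \<in> A') \<and> (x \<in> B \<longleftrightarrow> x \<in> B')"
  shows "pend n A B c = pend n A' B' c"
  using assms
proof (induction c rule: inc_induct)
  case (step c)
  then show ?case using pend_step[of c n A B] pend_step[of c n A' B'] by simp
qed simp

text \<open>The condition \<open>c \<notin> A\<close> reflects that columns are read top to bottom:
  a ball directly below comes later in the word and is thus available as a closer.\<close>

definition unmatched :: "nat \<Rightarrow> nat set \<Rightarrow> nat set \<Rightarrow> nat set" where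
  "unmatched n A B = {c \<in> B. 1 \<le> c \<and> c \<le> n \<and> c \<notin> A \<and> pend n A B c = 0}"

lemma finite_unmatched [simp]: "finite (unmatched n A B)"
  by (rule finite_subset[of _ "{1..n}"]) (auto simp: unmatched_def)

text \<open>Closed form of \<open>e_down_star n (Suc i)\<close>: all unmatched balls move at once.
  Rows are indexed from 0 from here on.\<close>

definition lower :: "nat \<Rightarrow> nat \<Rightarrow> nat set list \<Rightarrow> nat set list" where
  "lower n i N = N[Suc i := N ! Suc i - unmatched n (N ! i) (N ! Suc i),
                   i := N ! i \<union> unmatched n (N ! i) (N ! Suc i)]"

section \<open>Reading the column word column by column\<close>

definition col_balls :: "nat set list \<Rightarrow> nat \<Rightarrow> nat list \<Rightarrow> (nat \<times> nat) list" where
  "col_balls N c rs = concat (map (\<lambda>r. if c \<in> row N r then [(r, c)] else []) rs)"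

lemma col_balls_append: "col_balls N c (rs @ rs') = col_balls N c rs @ col_balls N c rs'"
  by (simp add: col_balls_def)

lemma set_col_balls: "set (col_balls N c rs) = {(r, c) |r. r \<in> set rs \<and> c \<in> row N r}"
  by (auto simp: col_balls_def split: if_splits)

lemma ball_seq_eq:
  "ball_seq n N = concat (map (\<lambda>c. col_balls N c (rev [1..<Suc (length N)])) [1..<Suc n])"
  by (simp add: ball_seq_def col_balls_def)

lemma scan_skip: "j \<notin> set zs \<Longrightarrow> Suc j \<notin> set zs \<Longrightarrow> scan j (zs @ w) = scan j w"
  by (induction zs) auto

lemma scan_col_balls_skip:
  assumes "j \<notin> set rs" "Suc j \<notin> set rs"
  shows "scan j (map fst (col_balls N c rs) @ w) = scan j w"
  by (rule scan_skip) (use assms in \<open>auto simp: set_col_balls\<close>)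

lemma upt_split:
  assumes "1 \<le> j" "j < l"
  shows "rev [1..<Suc l] = rev [Suc (Suc j)..<Suc l] @ [Suc j] @ [j] @ rev [1..<j]"
proof -
  have "[1..<Suc l] = [1..<j] @ [j..<Suc l]"
    using assms upt_add_eq_append[of 1 j "Suc l - j"] by simp
  also have "[j..<Suc l] = j # Suc j # [Suc (Suc j)..<Suc l]"
    using assms by (simp add: upt_conv_Cons)
  finally show ?thesis by simp
qed

lemma scan_low:
  assumes "1 \<le> j"
  shows "scan j (map fst (col_balls N c ([j] @ rev [1..<j])) @ w)
    = scan j w + of_bool (c \<in> row N j)"
proof -
  have "scan j (map fst (col_balls N c (rev [1..<j])) @ w) = scan j w"
    by (rule scan_col_balls_skip) auto
  then show ?thesis unfolding col_balls_append by (simp add: col_balls_def)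
qed

lemma scan_col:
  assumes "1 \<le> j" "j < length N"
  shows "scan j (map fst (col_balls N c (rev [1..<Suc (length N)])) @ w)
    = scan j w + of_bool (c \<in> row N j) - of_bool (c \<in> row N (Suc j))"
proof -
  let ?v = "map fst (col_balls N c ([j] @ rev [1..<j])) @ w"
  have "map fst (col_balls N c (rev [1..<Suc (length N)])) @ w =
     map fst (col_balls N c (rev [Suc (Suc j)..<Suc (length N)])) @
     map fst (col_balls N c [Suc j]) @ ?v"
    unfolding upt_split[OF assms] col_balls_append by simp
  moreover have "scan j (map fst (col_balls N c (rev [Suc (Suc j)..<Suc (length N)])) @ v) = scan j v" for v
    by (rule scan_col_balls_skip) auto
  moreover have "scan j (map fst (col_balls N c [Suc j]) @ ?v) = scan j ?v - of_bool (c \<in> row N (Suc j))"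
    by (simp add: col_balls_def)
  ultimately show ?thesis using scan_low[OF assms(1), of N c w] by simp
qed

lemma scan_cols:
  assumes "1 \<le> j" "j < length N" "c \<le> n"
  shows "scan j (map fst (concat (map (\<lambda>c. col_balls N c (rev [1..<Suc (length N)])) [Suc c..<Suc n])))
    = pend n (row N j) (row N (Suc j)) c"
  using assms(3)
proof (induction c rule: inc_induct)
  case (step c)
  have "[Suc c..<Suc n] = Suc c # [Suc (Suc c)..<Suc n]" using step by (simp add: upt_conv_Cons)
  then show ?case using step scan_col[OF assms(1,2)] pend_step[of c n] by simp
qed simp

lemma set_ball_seq:
  "set (ball_seq n N) = {(r, c). 1 \<le> c \<and> c \<le> n \<and> 1 \<le> r \<and> r \<le> length N \<and> c \<in> row N r}"
  by (auto simp: ball_seq_eq set_col_balls)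

lemma scan_cw_drop:
  assumes "1 \<le> j" "j < length N" "p < length (ball_seq n N)" "ball_seq n N ! p = (Suc j, c)"
  shows "scan j (drop (Suc p) (cw n N))
    = pend n (row N j) (row N (Suc j)) c + of_bool (c \<in> row N j)"
proof -
  let ?f = "\<lambda>c. col_balls N c (rev [1..<Suc (length N)])"
  have mem: "(Suc j, c) \<in> set (ball_seq n N)" using assms nth_mem by metis
  then have c: "1 \<le> c" "c \<le> n" "c \<in> row N (Suc j)" by (auto simp: set_ball_seq)
  have "[1..<Suc n] = [1..<c] @ [c..<Suc n]"
    using c upt_add_eq_append[of 1 c "Suc n - c"] by simp
  also have "[c..<Suc n] = c # [Suc c..<Suc n]" using c by (simp add: upt_conv_Cons)
  finally have "ball_seq n N = concat (map ?f [1..<c]) @ ?f c @ concat (map ?f [Suc c..<Suc n])"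
    by (simp add: ball_seq_eq)
  moreover have "?f c = col_balls N c (rev [Suc (Suc j)..<Suc (length N)]) @ (Suc j, c) #
      col_balls N c ([j] @ rev [1..<j])"
    unfolding upt_split[OF assms(1,2)] col_balls_append using c by (simp add: col_balls_def)
  ultimately obtain xs ys where
    seq: "ball_seq n N = xs @ (Suc j, c) # ys" and
    xs: "xs = concat (map ?f [1..<c]) @ col_balls N c (rev [Suc (Suc j)..<Suc (length N)])" and
    ys: "ys = col_balls N c ([j] @ rev [1..<j]) @ concat (map ?f [Suc c..<Suc n])"
    by simp
  have "(Suc j, c) \<notin> set xs" "(Suc j, c) \<notin> set ys"
    unfolding xs ys by (auto simp: set_col_balls)
  moreover have "p < length xs \<Longrightarrow> ball_seq n N ! p \<in> set xs"
    unfolding seq by (simp add: nth_append)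
  moreover have "length xs < p \<Longrightarrow> ball_seq n N ! p \<in> set ys"
    using assms(3) unfolding seq by (auto simp: nth_append nth_Cons')
  ultimately have "p = length xs"
    using assms(4) by (cases p "length xs" rule: linorder_cases) auto
  then have "drop (Suc p) (cw n N) = map fst ys" by (simp add: cw_def seq drop_map)
  then show ?thesis
    using scan_low[OF assms(1)] scan_cols[OF assms(1,2) c(2)] unfolding ys by simp
qed

lemma unmatched_open_cw_iff:
  assumes "1 \<le> j" "j < length N"
  shows "unmatched_open (cw n N) j p \<longleftrightarrow> p < length (ball_seq n N) \<and>
    (\<exists>c \<in> unmatched n (row N j) (row N (Suc j)). ball_seq n N ! p = (Suc j, c))"
proof (cases "p < length (ball_seq n N) \<and> fst (ball_seq n N ! p) = Suc j")
  case True
  then obtain c where c: "ball_seq n N ! p = (Suc j, c)" by (metis prod.collapse)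
  then have "(Suc j, c) \<in> set (ball_seq n N)" using True nth_mem by metis
  then have "1 \<le> c" "c \<le> n" "c \<in> row N (Suc j)" by (auto simp: set_ball_seq)
  then show ?thesis
    using scan_cw_drop[OF assms _ c] True c
    by (auto simp: unmatched_open_iff_scan unmatched_def cw_def)
next
  case False
  then show ?thesis by (auto simp: unmatched_open_iff_scan cw_def)
qed

lemma sorted_ball_seq: "sorted (map snd (ball_seq n N))"
proof -
  let ?f = "\<lambda>c. col_balls N c (rev [1..<Suc (length N)])"
  have one: "sorted (map snd (col_balls N c rs))" for c rs
    by (induction rs) (auto simp: col_balls_def)
  have "sorted cs \<Longrightarrow> sorted (map snd (concat (map ?f cs)))" for cs
    by (induction cs) (auto simp: sorted_append one set_col_balls simp del: upt_Suc)
  then show ?thesis by (simp add: ball_seq_eq del: upt_Suc)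
qed

lemma e_down_eq:
  fixes n :: nat
  assumes "1 \<le> j" "j < length N"
  defines "U \<equiv> unmatched n (row N j) (row N (Suc j))"
  shows "e_down n j N = (if U = {} then N else move_down j (Min U) N)"
proof -
  let ?P = "\<lambda>p. unmatched_open (cw n N) j p"
  let ?s = "ball_seq n N"
  note iff = unmatched_open_cw_iff[OF assms(1,2), of n, folded U_def]
  have ex: "\<exists>p. ?P p \<and> ?s ! p = (Suc j, c)" if "c \<in> U" for c
  proof -
    have "(Suc j, c) \<in> set ?s" using that assms by (auto simp: U_def unmatched_def set_ball_seq)
    then obtain p where "p < length ?s" "?s ! p = (Suc j, c)" by (metis in_set_conv_nth)
    then show ?thesis using that iff by blast
  qed
  show ?thesis
  proof (cases "U = {}")
    case True
    then show ?thesis by (simp add: e_down_def iff)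
  next
    case False
    then have "\<exists>p. ?P p" using ex by blast
    then have L: "?P (Least ?P)" by (rule LeastI_ex)
    then obtain c where c: "c \<in> U" "?s ! Least ?P = (Suc j, c)" "Least ?P < length ?s"
      using iff by blast
    have "c \<le> d" if d: "d \<in> U" for d
    proof -
      obtain p where p: "?P p" "?s ! p = (Suc j, d)" using ex[OF d] by blast
      then have "Least ?P \<le> p" "p < length ?s" using iff by (auto intro: Least_le)
      then have "map snd ?s ! Least ?P \<le> map snd ?s ! p"
        using sorted_ball_seq by (intro sorted_nth_mono) auto
      then show ?thesis using c p \<open>p < length ?s\<close> by simp
    qed
    then have "c = Min U" using c(1) by (intro Min_eqI[symmetric]) (auto simp: U_def)
    then show ?thesis using False \<open>\<exists>p. ?P p\<close> c by (simp add: e_down_def)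
  qed
qed

text \<open>The moved ball becomes a closer that no ball to its left needs. As no unmatched ball
  lies to the left, no truncation occurs there, and the pending count simply grows by one. So
  iterating \<open>e_down\<close> drains a set that is fixed in advance.\<close>

lemma unmatched_move:
  assumes "c \<in> unmatched n A B" "\<And>d. d \<in> unmatched n A B \<Longrightarrow> c \<le> d"
  shows "unmatched n (insert c A) (B - {c}) = unmatched n A B - {c}"
proof -
  let ?q = "pend n A B" and ?q' = "pend n (insert c A) (B - {c})"
  have c: "c \<in> B" "1 \<le> c" "c \<le> n" "c \<notin> A" "?q c = 0" using assms by (auto simp: unmatched_def)
  have hi: "?q' x = ?q x" if "c \<le> x" "x \<le> n" for x
    by (rule pend_cong[of _ n]) (use that in auto)
  obtain c' where c': "c = Suc c'" using c by (cases c) auto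
  have lo: "?q' x = Suc (?q x)" if "x \<le> c'" for x
    using that
  proof (induction x rule: inc_induct)
    case base
    show ?case using pend_step[of c' n A B] pend_step[of c' n "insert c A" "B - {c}"] hi[of c] c c' by simp
  next
    case (step x)
    have "Suc x \<notin> unmatched n A B" using assms(2)[of "Suc x"] step c' by auto
    then show ?case using pend_step[of x n A B] pend_step[of x n "insert c A" "B - {c}"] step c c'
      by (auto simp: unmatched_def)
  qed
  show ?thesis
  proof (rule set_eqI)
    fix x
    show "x \<in> unmatched n (insert c A) (B - {c}) \<longleftrightarrow> x \<in> unmatched n A B - {c}"
    proof (cases "c \<le> x")
      case True
      then show ?thesis using hi[of x] by (auto simp: unmatched_def)
    next
      case False
      then have "x \<notin> unmatched n A B" using assms(2)[of x] by auto
      then show ?thesis using lo[of x] False c' by (auto simp: unmatched_def)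
    qed
  qed
qed

lemma e_down_star_eq_lower:
  assumes "Suc i < length N"
  shows "e_down_star n (Suc i) N = lower n i N"
  using assms
proof (induction "card (unmatched n (N ! i) (N ! Suc i))" arbitrary: N)
  case 0
  then have "unmatched n (N ! i) (N ! Suc i) = {}" by simp
  then have "e_down n (Suc i) N = N" "lower n i N = N"
    using e_down_eq[of "Suc i" N n] 0 by (simp_all add: row_def lower_def)
  then show ?case unfolding e_down_star_def by (subst while_unfold) simp
next
  case (Suc k)
  let ?U = "unmatched n (N ! i) (N ! Suc i)"
  let ?c = "Min ?U"
  let ?N = "move_down (Suc i) ?c N"
  have ne: "?U \<noteq> {}" using Suc(2) by auto
  have cU: "?c \<in> ?U" "\<And>d. d \<in> ?U \<Longrightarrow> ?c \<le> d" using ne by auto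
  have ed: "e_down n (Suc i) N = ?N" using e_down_eq[of "Suc i" N n] ne Suc by (simp add: row_def)
  have nth: "?N ! i = insert ?c (N ! i)" "?N ! Suc i = N ! Suc i - {?c}" "length ?N = length N"
    using Suc by (auto simp: move_down_def row_def)
  have "?c \<notin> N ! i" using cU by (auto simp: unmatched_def)
  then have "?N ! i \<noteq> N ! i" using nth by auto
  then have "?N \<noteq> N" by metis
  then have "e_down_star n (Suc i) N = e_down_star n (Suc i) ?N"
    unfolding e_down_star_def by (subst while_unfold) (simp add: ed)
  also have "\<dots> = lower n i ?N"
    by (rule Suc(1)) (use Suc nth unmatched_move[OF cU] cU in auto)
  also have "\<dots> = lower n i N"
    using Suc(3) unmatched_move[OF cU] cU
    by (intro nth_equalityI) (auto simp: lower_def nth nth_list_update move_down_def row_def)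
  finally show ?case .
qed


section \<open>Suffix counts and nonwrapping queues\<close>

definition suf :: "nat \<Rightarrow> nat set \<Rightarrow> nat \<Rightarrow> nat" where
  "suf n X c = card (X \<inter> {c..n})"

lemma suf_step:
  assumes "c \<le> n"
  shows "suf n X c = of_bool (c \<in> X) + suf n X (Suc c)"
proof -
  have "{c..n} = insert c {Suc c..n}" using assms by auto
  then show ?thesis unfolding suf_def by auto
qed

lemma suf_top [simp]: "n < c \<Longrightarrow> suf n X c = 0"
  by (simp add: suf_def)

lemma suf_mono: "X \<subseteq> Y \<Longrightarrow> suf n X c \<le> suf n Y c"
  unfolding suf_def by (intro card_mono) auto

lemma suf_antimono: "c \<le> d \<Longrightarrow> suf n X d \<le> suf n X c"
  unfolding suf_def by (intro card_mono) auto

lemma suf_union: "X \<inter> Y = {} \<Longrightarrow> suf n (X \<union> Y) c = suf n X c + suf n Y c"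
  unfolding suf_def by (subst card_Un_disjoint[symmetric]) (auto simp: Int_Un_distrib2)

lemma suf_diff: "Y \<subseteq> X \<Longrightarrow> suf n (X - Y) c + suf n Y c = suf n X c"
  using suf_union[of "X - Y" Y n c] by (simp add: Un_absorb2 Int_commute)

lemma unmatched_subset: "unmatched n A B \<subseteq> B"
  by (auto simp: unmatched_def)

lemma unmatched_disjoint: "A \<inter> unmatched n A B = {}"
  by (auto simp: unmatched_def)

text \<open>Conservation: a lower ball right of \<open>c\<close> is either used by a matched upper
  ball right of \<open>c\<close> or still pending.\<close>

lemma pend_suf:
  "c \<le> n \<Longrightarrow> pend n A B c + suf n (B - unmatched n A B) (Suc c) = suf n A (Suc c)"
proof (induction c rule: inc_induct)
  case (step c)
  have "\<not> (Suc c \<in> B \<and> Suc c \<notin> unmatched n A B \<and> pend n A B (Suc c) = 0 \<and> Suc c \<notin> A)"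
    using step by (auto simp: unmatched_def)
  moreover have "Suc c \<in> unmatched n A B \<Longrightarrow> pend n A B (Suc c) = 0 \<and> Suc c \<notin> A \<and> Suc c \<in> B"
    by (auto simp: unmatched_def)
  ultimately show ?case
    using step pend_step[of c n A B] suf_step[of "Suc c" n A]
      suf_step[of "Suc c" n "B - unmatched n A B"]
    by (auto split: if_splits)
qed simp

lemma suf_diff_unmatched_le: "1 \<le> c \<Longrightarrow> suf n (B - unmatched n A B) c \<le> suf n A c"
  using pend_suf[of "c - 1" n A B] by (cases "c \<le> n"; cases c) auto

text \<open>Nothing is pending at an unmatched ball, so every lower ball from there on is used by a
  matched upper one.\<close>

lemma suf_at_unmatched:
  assumes "t \<in> unmatched n A B"
  shows "suf n B t = suf n A t + suf n (unmatched n A B) t"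
proof -
  obtain t' where t: "t = Suc t'" "t' < n" using assms by (cases t) (auto simp: unmatched_def)
  have "pend n A B t' = 0" using assms pend_step[of t' n A B] t by (auto simp: unmatched_def)
  then show ?thesis
    using pend_suf[of t' n A B] t suf_diff[OF unmatched_subset[of n A B], of n t] by simp
qed

text \<open>Allows a cutoff column to slide right to the next unmatched ball, where
  \<open>suf_at_unmatched\<close> gives an exact count.\<close>

lemma suf_unmatched_cases:
  obtains "suf n (unmatched n A B) c = 0"
  | t where "t \<in> unmatched n A B" "c \<le> t" "suf n (unmatched n A B) c = suf n (unmatched n A B) t"
proof (cases "unmatched n A B \<inter> {c..n} = {}")
  case True
  then show ?thesis using that(1) by (simp add: suf_def)
next
  case False
  let ?t = "Min (unmatched n A B \<inter> {c..n})"
  have t: "?t \<in> unmatched n A B \<inter> {c..n}" using False by (intro Min_in) auto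
  have "unmatched n A B \<inter> {c..n} = unmatched n A B \<inter> {?t..n}" using t by auto
  then show ?thesis using that(2)[of ?t] t by (simp add: suf_def)
qed

text \<open>Domination of each row by the one below it says that no ball has to wrap around when the
  rows are paired; these are the highest weight elements for the lowering operators.\<close>

definition dominates :: "nat \<Rightarrow> nat set \<Rightarrow> nat set \<Rightarrow> bool" where
  "dominates n A B \<longleftrightarrow> (\<forall>c \<ge> 1. suf n B c \<le> suf n A c)"

lemma dominates_iff: "dominates n A B \<longleftrightarrow> unmatched n A B = {}"
proof
  assume d: "dominates n A B"
  show "unmatched n A B = {}"
  proof (rule ccontr)
    assume "unmatched n A B \<noteq> {}"
    then obtain t where t: "t \<in> unmatched n A B" by blast
    then have "1 \<le> t" "t \<in> unmatched n A B \<inter> {t..n}" by (auto simp: unmatched_def)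
    then have "0 < suf n (unmatched n A B) t" by (auto simp: suf_def card_gt_0_iff)
    then show False using d suf_at_unmatched[OF t] \<open>1 \<le> t\<close> by (fastforce simp: dominates_def)
  qed
next
  assume "unmatched n A B = {}"
  then show "dominates n A B" using suf_diff_unmatched_le[of _ n B A] by (auto simp: dominates_def)
qed

lemma dominates_mono: "dominates n A B \<Longrightarrow> A \<subseteq> A' \<Longrightarrow> B' \<subseteq> B \<Longrightarrow> dominates n A' B'"
  unfolding dominates_def by (meson order_trans suf_mono)

abbreviation nonwrapping :: "nat \<Rightarrow> nat set list \<Rightarrow> bool" where
  "nonwrapping n \<equiv> successively (dominates n)"

lemma length_lower [simp]: "length (lower n i N) = length N"
  by (simp add: lower_def)

lemma lower_0 [simp]:
  "lower n 0 (A # B # r) = (A \<union> unmatched n A B) # (B - unmatched n A B) # r"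
  by (simp add: lower_def)

lemma lower_Suc [simp]: "lower n (Suc i) (A # r) = A # lower n i r"
  by (simp add: lower_def)

text \<open>The operator with index \<open>[b, 1]\<close> on the lowest \<open>b + 1\<close> rows.\<close>

primrec push :: "nat \<Rightarrow> nat set list \<Rightarrow> nat set list" where
  "push n [] = []"
| "push n (A # r) = (if r = [] then [A] else lower n 0 (A # push n r))"

lemma length_push [simp]: "length (push n N) = length N"
  by (induction N) auto

lemma foldr_lower_Suc: "foldr (lower n) (map Suc js) (A # r) = A # foldr (lower n) js r"
  by (induction js) auto

lemma upt_0_Suc: "[0..<Suc k] = 0 # map Suc [0..<k]"
  by (simp add: map_Suc_upt upt_conv_Cons del: upt_Suc)

lemma lower_0_append: "r \<noteq> [] \<Longrightarrow> lower n 0 (A # r @ s) = lower n 0 (A # r) @ s"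
  by (cases r) auto

lemma foldr_lower_eq_push:
  "r \<noteq> [] \<Longrightarrow> foldr (lower n) [0..<length r - 1] (r @ s) = push n r @ s"
proof (induction r)
  case (Cons A r)
  show ?case
  proof (cases r)
    case (Cons B r')
    then have "push n r \<noteq> []" using length_push[of n r] by force
    moreover have "[0..<length (A # r) - 1] = 0 # map Suc [0..<length r - 1]"
      using upt_0_Suc[of "length r'"] Cons by (simp del: upt_Suc)
    ultimately show ?thesis using Cons.IH Cons
      by (simp add: foldr_lower_Suc lower_0_append del: upt_Suc push.simps)
        (simp)
  qed simp
qed simp

text \<open>Nonwrapping alone is too weak for the induction, because the next step takes balls out
  of \<open>H\<close>. The invariant therefore says that the rows above are dominated already by the
  old bottom row \<open>hd xs\<close>.\<close>

lemma push_cases: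
  assumes "xs \<noteq> []" "nonwrapping n xs"
  shows "\<exists>H T. push n (xs @ [Z]) = H # T \<and> T \<noteq> [] \<and> hd xs \<subseteq> H \<and> nonwrapping n T \<and>
    dominates n (hd xs) (hd T)"
  using assms
proof (induction xs)
  case (Cons A xs)
  show ?case
  proof (cases xs)
    case Nil
    then show ?thesis using suf_diff_unmatched_le by (auto simp: dominates_def)
  next
    case (Cons A2 ys)
    then have dA: "dominates n A A2" and "nonwrapping n xs" using Cons.prems by auto
    then obtain H T where HT: "push n (xs @ [Z]) = H # T" "T \<noteq> []" "A2 \<subseteq> H" "nonwrapping n T"
        "dominates n A2 (hd T)"
      using Cons.IH Cons by auto
    let ?U = "unmatched n A H"
    \<comment> \<open>From any column on, \<open>H\<close> loses at most as many balls as it had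
      gained over \<open>A2\<close>, because \<open>A\<close> dominates \<open>A2\<close>.\<close>
    have d2: "suf n A2 c \<le> suf n (H - ?U) c" if "1 \<le> c" for c
    proof (rule suf_unmatched_cases[of n A H c])
      assume "suf n ?U c = 0"
      then show ?thesis
        using suf_diff[OF unmatched_subset[of n A H], of n c] suf_mono[OF HT(3), of n c] by simp
    next
      fix t assume t: "t \<in> ?U" "c \<le> t" "suf n ?U c = suf n ?U t"
      have "suf n A2 t \<le> suf n A t" using dA t that by (auto simp: dominates_def)
      moreover have "suf n (H - A2) t \<le> suf n (H - A2) c" using suf_antimono t by blast
      ultimately show ?thesis
        using suf_at_unmatched[OF t(1)] t suf_diff[OF HT(3), of n t] suf_diff[OF HT(3), of n c]
          suf_diff[OF unmatched_subset[of n A H], of n c]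
        by linarith
    qed
    then have "dominates n (H - ?U) (hd T)"
      using HT(5) unfolding dominates_def by (meson order_trans)
    then have "nonwrapping n ((H - ?U) # T)" using HT by (cases T) auto
    moreover have "dominates n A (H - ?U)" using suf_diff_unmatched_le by (auto simp: dominates_def)
    moreover have "push n ((A # xs) @ [Z]) = (A \<union> ?U) # (H - ?U) # T" using HT by simp
    ultimately show ?thesis by auto
  qed
qed simp

lemma nonwrapping_push:
  assumes "nonwrapping n xs"
  shows "nonwrapping n (push n (xs @ [Z]))"
proof (cases "xs = []")
  case False
  then obtain H T where HT: "push n (xs @ [Z]) = H # T" "T \<noteq> []" "hd xs \<subseteq> H" "nonwrapping n T"
      "dominates n (hd xs) (hd T)"
    using push_cases[OF _ assms] by blast
  then have "dominates n H (hd T)" using dominates_mono by blast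
  then show ?thesis using HT by (cases T) auto
qed simp

text \<open>Inserts a new bottom row \<open>B\<close> below a nonwrapping tuple, applying the lowering operators from the
  bottom up; compare \<open>push\<close>, which inserts a new top row.\<close>

fun ins :: "nat \<Rightarrow> nat set \<Rightarrow> nat set list \<Rightarrow> nat set list" where
  "ins n B [] = [B]"
| "ins n B (Y # r) = (B \<union> unmatched n B Y) # ins n (Y - unmatched n B Y) r"

lemma fold_lower_Suc: "fold (lower n) (map Suc js) (A # r) = A # fold (lower n) js r"
  by (induction js arbitrary: r) auto

lemma fold_lower_eq_ins: "fold (lower n) [0..<length r] (B # r) = ins n B r"
  by (induction r arbitrary: B) (simp_all add: upt_0_Suc fold_lower_Suc del: upt_Suc)

lemma nonwrapping_ins: "nonwrapping n Ns \<Longrightarrow> nonwrapping n (ins n B Ns)"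
proof (induction Ns arbitrary: B)
  case (Cons Y r)
  let ?U = "unmatched n B Y"
  show ?case
  proof (cases r)
    case Nil
    have "dominates n B (Y - ?U)" using suf_diff_unmatched_le by (auto simp: dominates_def)
    then have "dominates n (B \<union> ?U) (Y - ?U)" by (rule dominates_mono) auto
    then show ?thesis using Nil by simp
  next
    case (Cons Y2 r2)
    let ?V = "unmatched n (Y - ?U) Y2"
    have dY: "dominates n Y Y2" and "nonwrapping n r" using Cons.prems Cons by auto
    then have nonwrapping: "nonwrapping n (ins n (Y - ?U) r)" using Cons.IH by blast
    have "suf n ((Y - ?U) \<union> ?V) c \<le> suf n (B \<union> ?U) c" if c: "1 \<le> c" for c
    proof -
      \<comment> \<open>\<open>Y\<close> dominates \<open>Y2\<close>, so the shortfall of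
        \<open>Y - ?U\<close> against \<open>Y2\<close> is at most what the removal of
        \<open>?U\<close> caused.\<close>
      have "suf n ?V c \<le> suf n ?U c"
      proof (rule suf_unmatched_cases[of n "Y - ?U" Y2 c])
        fix t assume t: "t \<in> ?V" "c \<le> t" "suf n ?V c = suf n ?V t"
        have "suf n Y2 t \<le> suf n Y t" using dY t c by (auto simp: dominates_def)
        then show ?thesis
          using suf_at_unmatched[OF t(1)] t suf_antimono[of c t n ?U]
            suf_diff[OF unmatched_subset[of n B Y], of n t]
          by linarith
      qed simp
      then show ?thesis
        using suf_union[OF unmatched_disjoint[of "Y - ?U" n Y2], of n c] suf_union[OF unmatched_disjoint[of B n Y], of n c]
          suf_diff[OF unmatched_subset[of n B Y], of n c] suf_diff_unmatched_le[OF c, of n Y B]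
        by linarith
    qed
    then have "dominates n (B \<union> ?U) ((Y - ?U) \<union> ?V)" by (simp add: dominates_def)
    then show ?thesis using nonwrapping Cons by simp
  qed
qed simp


section \<open>Raising operators on adjacent columns\<close>

text \<open>\<open>raise_col m 0\<close> brackets the balls of columns \<open>m\<close> and \<open>m + 1\<close> and moves the unmatched ones of column
  \<open>m + 1\<close> to column \<open>m\<close>. Rows are read bottom to top; the counter \<open>k\<close> is the number of balls that are
  alone in column \<open>m\<close> of their row and still free to be matched by a ball of a higher row.\<close>

definition flip :: "nat \<Rightarrow> nat \<Rightarrow> nat set \<Rightarrow> nat set" where
  "flip m k X = (if k = 0 \<and> m \<notin> X \<and> Suc m \<in> X then insert m (X - {Suc m}) else X)"

definition upd :: "nat \<Rightarrow> nat \<Rightarrow> nat set \<Rightarrow> nat" where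
  "upd m k X = (if m \<in> X \<and> Suc m \<notin> X then Suc k else if m \<notin> X \<and> Suc m \<in> X then k - 1 else k)"

fun raise_col :: "nat \<Rightarrow> nat \<Rightarrow> nat set list \<Rightarrow> nat set list" where
  "raise_col m k [] = []"
| "raise_col m k (X # r) = flip m k X # raise_col m (upd m k X) r"

lemma length_raise_col [simp]: "length (raise_col m k N) = length N"
  by (induction N arbitrary: k) auto

lemma flip_other: "x \<noteq> m \<Longrightarrow> x \<noteq> Suc m \<Longrightarrow> x \<in> flip m k X \<longleftrightarrow> x \<in> X"
  by (auto simp: flip_def)

lemma flip_left: "m \<in> flip m k X \<longleftrightarrow> m \<in> X \<or> (k = 0 \<and> Suc m \<in> X)"
  by (auto simp: flip_def)

lemma flip_right: "Suc m \<in> flip m k X \<longleftrightarrow> Suc m \<in> X \<and> (k = 0 \<longrightarrow> m \<in> X)"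
  by (auto simp: flip_def)

text \<open>The local form of the commutation of row and column operators. The flips leave the
  pending count left of column \<open>m\<close> unchanged, so balls outside columns \<open>m\<close>
  and \<open>Suc m\<close> notice nothing. What remains is a check of the four sites of a 2 by 2
  block against the counters \<open>k\<close> and \<open>q\<close>. The third equation says that the
  rows above see the same counter.\<close>

lemma flip_unmatched:
  fixes A B :: "nat set" and k m n :: nat
  assumes "1 \<le> m" "m < n"
  defines "A' \<equiv> flip m k A" and "B' \<equiv> flip m (upd m k A) B"
  defines "U \<equiv> unmatched n A B" and "U' \<equiv> unmatched n A' B'"
  shows "A' \<union> U' = flip m k (A \<union> U)"
    and "B' - U' = flip m (upd m k (A \<union> U)) (B - U)"
    and "upd m (upd m k A) B = upd m (upd m k (A \<union> U)) (B - U)"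
proof -
  obtain l where m: "m = Suc l" using assms by (cases m) auto
  define q where "q = pend n A B (Suc m)"
  have q': "pend n A' B' (Suc m) = q"
    unfolding q_def by (rule pend_cong[of _ n]) (use assms in \<open>auto simp: A'_def B'_def flip_other\<close>)
  have p1: "pend n A B m = q + of_bool (Suc m \<in> A) - of_bool (Suc m \<in> B)"
    using pend_step[of m n A B] assms q_def by simp
  have p1': "pend n A' B' m = q + of_bool (Suc m \<in> A') - of_bool (Suc m \<in> B')"
    using pend_step[of m n A' B'] assms q' by simp
  have p2: "pend n A B l = pend n A B m + of_bool (m \<in> A) - of_bool (m \<in> B)"
    using pend_step[of l n A B] assms m by simp
  have p2': "pend n A' B' l = pend n A' B' m + of_bool (m \<in> A') - of_bool (m \<in> B')"
    using pend_step[of l n A' B'] assms m by simp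
  note bits = A'_def B'_def flip_left flip_right upd_def
  \<comment> \<open>The lower row can decrease the counter by one before the upper row tests it for
    0, so 0, 1 and larger values have to be separated.\<close>
  obtain k' where "k = 0 \<or> k = Suc 0 \<or> k = Suc (Suc k')"
    by (metis not0_implies_Suc)
  then have l: "pend n A' B' l = pend n A B l"
    unfolding p2 p2' p1 p1' unfolding bits
    by (elim disjE; cases "m \<in> A"; cases "m \<in> B"; cases "Suc m \<in> A"; cases "Suc m \<in> B"; simp)
  have other: "x \<in> U' \<longleftrightarrow> x \<in> U" if "x \<noteq> m" "x \<noteq> Suc m" for x
  proof -
    have "pend n A' B' x = pend n A B x" if "x \<le> n"
    proof (cases "x \<le> l")
      case True
      then show ?thesis
        by (rule pend_cong[OF _ _ l]) (use True assms m in \<open>auto simp: A'_def B'_def flip_other\<close>)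
    next
      case False
      show ?thesis
        by (rule pend_cong[of _ n])
          (use False \<open>x \<noteq> m\<close> \<open>x \<noteq> Suc m\<close> assms m that in \<open>auto simp: A'_def B'_def flip_other\<close>)
    qed
    then show ?thesis using that by (auto simp: U_def U'_def unmatched_def A'_def B'_def flip_other)
  qed
  have UR: "Suc m \<in> U \<longleftrightarrow> Suc m \<in> B \<and> Suc m \<notin> A \<and> q = 0"
    using assms q_def by (auto simp: U_def unmatched_def)
  have UR': "Suc m \<in> U' \<longleftrightarrow> Suc m \<in> B' \<and> Suc m \<notin> A' \<and> q = 0"
    using assms(1,2) q' by (auto simp: U'_def unmatched_def)
  have UL: "m \<in> U \<longleftrightarrow> m \<in> B \<and> m \<notin> A \<and> q + of_bool (Suc m \<in> A) - of_bool (Suc m \<in> B) = 0"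
    using assms p1 by (auto simp: U_def unmatched_def)
  have UL': "m \<in> U' \<longleftrightarrow> m \<in> B' \<and> m \<notin> A' \<and> q + of_bool (Suc m \<in> A') - of_bool (Suc m \<in> B') = 0"
    using assms(1,2) p1' by (auto simp: U'_def unmatched_def)
  have c1: "(m \<in> A' \<union> U' \<longleftrightarrow> m \<in> flip m k (A \<union> U)) \<and> (Suc m \<in> A' \<union> U' \<longleftrightarrow> Suc m \<in> flip m k (A \<union> U))"
    unfolding Un_iff UL' UR' flip_left flip_right UL UR bits
    by (cases "m \<in> A"; cases "m \<in> B"; cases "Suc m \<in> A"; cases "Suc m \<in> B"; cases "k = 0"; cases "q = 0") auto
  have c2: "(m \<in> B' - U' \<longleftrightarrow> m \<in> flip m (upd m k (A \<union> U)) (B - U)) \<and>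
      (Suc m \<in> B' - U' \<longleftrightarrow> Suc m \<in> flip m (upd m k (A \<union> U)) (B - U))"
    unfolding Diff_iff UL' UR' flip_left flip_right UL UR bits Un_iff
    by (cases "m \<in> A"; cases "m \<in> B"; cases "Suc m \<in> A"; cases "Suc m \<in> B"; cases "k = 0"; cases "q = 0") auto
  show "upd m (upd m k A) B = upd m (upd m k (A \<union> U)) (B - U)"
    unfolding upd_def Un_iff Diff_iff UL UR
    by (cases "m \<in> A"; cases "m \<in> B"; cases "Suc m \<in> A"; cases "Suc m \<in> B"; cases "k = 0"; cases "q = 0") auto
  show "A' \<union> U' = flip m k (A \<union> U)"
  proof (rule set_eqI)
    fix x show "x \<in> A' \<union> U' \<longleftrightarrow> x \<in> flip m k (A \<union> U)"
      by (cases "x = m"; cases "x = Suc m") (use c1 in \<open>auto simp: other A'_def flip_other\<close>)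
  qed
  show "B' - U' = flip m (upd m k (A \<union> U)) (B - U)"
  proof (rule set_eqI)
    fix x show "x \<in> B' - U' \<longleftrightarrow> x \<in> flip m (upd m k (A \<union> U)) (B - U)"
      by (cases "x = m"; cases "x = Suc m") (use c2 in \<open>auto simp: other B'_def flip_other\<close>)
  qed
qed

lemma raise_col_lower:
  assumes "1 \<le> m" "m < n" "Suc i < length N"
  shows "raise_col m k (lower n i N) = lower n i (raise_col m k N)"
  using assms(3)
proof (induction i arbitrary: k N)
  case 0
  then obtain A B r where N: "N = A # B # r"
    by (metis length_0_conv length_Cons less_nat_zero_code list.exhaust less_Suc0)
  show ?case unfolding N using flip_unmatched[OF assms(1,2), of k A B] by simp
next
  case (Suc i)
  then obtain A r where N: "N = A # r" by (cases N) auto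
  show ?case using Suc unfolding N by simp
qed

lemma raise_col_fold_lower:
  assumes "1 \<le> m" "m < n" "\<forall>i \<in> set js. Suc i < length N"
  shows "raise_col m k (fold (lower n) js N) = fold (lower n) js (raise_col m k N)"
  using assms(3)
  by (induction js arbitrary: N) (simp_all add: raise_col_lower[OF assms(1,2)])

definition col_weight :: "nat \<Rightarrow> nat set list \<Rightarrow> nat" where
  "col_weight c N = length (filter (\<lambda>X. c \<in> X) N)"

lemma col_weight_simps [simp]:
  "col_weight c [] = 0" "col_weight c (X # r) = of_bool (c \<in> X) + col_weight c r"
  by (simp_all add: col_weight_def)

lemma col_weight_lower:
  "Suc i < length N \<Longrightarrow> col_weight c (lower n i N) = col_weight c N"
proof (induction i arbitrary: N)
  case 0
  then obtain A B r where N: "N = A # B # r"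
    by (metis length_0_conv length_Cons less_nat_zero_code list.exhaust less_Suc0)
  show ?case unfolding N by (auto simp: unmatched_def)
next
  case (Suc i)
  then show ?case by (cases N) auto
qed

lemma col_weight_fold_lower:
  "\<forall>i \<in> set js. Suc i < length N \<Longrightarrow> col_weight c (fold (lower n) js N) = col_weight c N"
  by (induction js arbitrary: N) (simp_all add: col_weight_lower)

lemma flip_eq_cases:
  assumes "flip m k X = flip m l Y"
  obtains "X = Y" | "k = 0" "m \<notin> X" "Suc m \<in> X" "m \<in> Y" "Suc m \<notin> Y"
  | "l = 0" "m \<notin> Y" "Suc m \<in> Y" "m \<in> X" "Suc m \<notin> X"
proof -
  consider "flip m k X = X" "flip m l Y = Y" | "flip m k X \<noteq> X" "flip m l Y = Y"
    | "flip m k X = X" "flip m l Y \<noteq> Y" | "flip m k X \<noteq> X" "flip m l Y \<noteq> Y" by blast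
  then show ?thesis
  proof cases
    case 1
    then show ?thesis using assms that by simp
  next
    case 2
    then show ?thesis using assms that(2) by (auto simp: flip_def split: if_splits)
  next
    case 3
    then show ?thesis using assms that(3) by (auto simp: flip_def split: if_splits)
  next
    case 4
    then have b: "m \<notin> X" "Suc m \<in> X" "m \<notin> Y" "Suc m \<in> Y" by (auto simp: flip_def split: if_splits)
    have "X = Y"
    proof (rule set_eqI)
      fix x show "x \<in> X \<longleftrightarrow> x \<in> Y"
        using b flip_other[of x m k X] flip_other[of x m l Y] assms
        by (cases "x = m"; cases "x = Suc m") auto
    qed
    then show ?thesis using that by simp
  qed
qed

text \<open>Prepares injectivity. With the larger, hence positive, counter no flip happens in the
  current row, so the two preimages can differ only where the smaller counter has flipped a ball out
  of column \<open>Suc m\<close>. The counters keep their order afterwards.\<close>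

lemma raise_col_weight_mono:
  assumes "raise_col m k N = raise_col m l N'" "k < l"
  shows "col_weight m N \<le> col_weight m N'"
  using assms
proof (induction N arbitrary: N' k l)
  case (Cons X r)
  then obtain Y s where N': "N' = Y # s" by (cases N') auto
  have f: "flip m k X = flip m l Y" "raise_col m (upd m k X) r = raise_col m (upd m l Y) s"
    using Cons.prems N' by auto
  have "\<not> (k = 0 \<and> m \<notin> X \<and> Suc m \<in> X \<and> X = Y)"
    using f(1) Cons.prems(2) by (auto simp: flip_def split: if_splits)
  then have *: "upd m k X < upd m l Y \<and> (m \<in> X \<longrightarrow> m \<in> Y)"
    by (rule_tac flip_eq_cases[OF f(1)]) (use Cons.prems(2) in \<open>auto simp: upd_def\<close>)
  then have "col_weight m r \<le> col_weight m s" using Cons.IH[OF f(2)] by blast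
  then show ?case using N' * by auto
qed simp

text \<open>At the first row where the preimages differ, one has its ball in column \<open>m\<close>
  and the other in \<open>Suc m\<close>. This separates the counters, and by
  \<open>raise_col_weight_mono\<close> the higher rows cannot compensate for the difference in
  weight.\<close>

lemma raise_col_inj:
  assumes "raise_col m k N = raise_col m k N'" "col_weight m N = col_weight m N'"
  shows "N = N'"
  using assms
proof (induction N arbitrary: N' k)
  case Nil
  then show ?case by (cases N') auto
next
  case (Cons X r)
  then obtain Y s where N': "N' = Y # s" by (cases N') auto
  have f: "flip m k X = flip m k Y" "raise_col m (upd m k X) r = raise_col m (upd m k Y) s"
    using Cons.prems N' by auto
  from f(1) show ?case
  proof (cases rule: flip_eq_cases)
    case 1
    then show ?thesis using Cons f N' by auto
  next
    case 2
    then have "col_weight m r \<le> col_weight m s"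
      by (intro raise_col_weight_mono[OF f(2)]) (auto simp: upd_def)
    then show ?thesis using 2 Cons.prems N' by auto
  next
    case 3
    then have "col_weight m s \<le> col_weight m r"
      by (intro raise_col_weight_mono[OF f(2)[symmetric]]) (auto simp: upd_def)
    then show ?thesis using 3 Cons.prems N' by auto
  qed
qed


section \<open>Uniqueness of the nonwrapping form\<close>

lemma raise_col_snoc:
  "raise_col m k (xs @ [X]) = raise_col m k xs @ [flip m (fold (\<lambda>X k. upd m k X) xs k) X]"
  by (induction xs arbitrary: k) auto

lemma fold_upd_zero:
  "\<forall>X \<in> set xs. m \<in> X \<longrightarrow> Suc m \<in> X \<Longrightarrow> fold (\<lambda>X k. upd m k X) xs 0 = 0"
  by (induction xs) (auto simp: upd_def)

lemma dominates_bound: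
  assumes "dominates n A B" "x \<in> B" "1 \<le> x" "x \<le> n"
  obtains y where "y \<in> A" "x \<le> y" "y \<le> n"
proof -
  have "x \<in> B \<inter> {x..n}" using assms by auto
  then have "0 < suf n B x" by (auto simp: suf_def card_gt_0_iff)
  then have "0 < suf n A x" using assms by (fastforce simp: dominates_def)
  then show ?thesis using that by (auto simp: suf_def card_gt_0_iff)
qed

text \<open>An element fixed by both kinds of operators is a Young diagram, hence determined by its column
  sums.\<close>

lemma raise_fixed_nested:
  assumes "nonwrapping n N" "\<forall>X \<in> set N. X \<subseteq> {1..n}" "\<forall>m. 1 \<le> m \<and> m < n \<longrightarrow> raise_col m 0 N = N"
  shows "sorted_wrt (\<supseteq>) N \<and> (\<forall>X \<in> set N. \<forall>x \<in> X. {1..x} \<subseteq> X)"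
  using assms
proof (induction N rule: rev_induct)
  case (snoc X xs)
  have IH: "sorted_wrt (\<supseteq>) xs" "\<forall>Y \<in> set xs. \<forall>x \<in> Y. {1..x} \<subseteq> Y"
    using snoc by (auto simp: raise_col_snoc successively_append_iff)
  have fX: "flip m (fold (\<lambda>X k. upd m k X) xs 0) X = X" if "1 \<le> m" "m < n" for m
    using snoc.prems(3) that by (simp add: raise_col_snoc)
  have X: "X \<subseteq> {1..n}" and xs: "\<forall>Y \<in> set xs. Y \<subseteq> {1..n}" using snoc.prems by auto
  have last_sub: "last xs \<subseteq> Y" if Y: "Y \<in> set xs" for Y
  proof -
    have "xs = butlast xs @ [last xs]" using Y by (metis append_butlast_last_id empty_iff empty_set)
    then have "sorted_wrt (\<supseteq>) (butlast xs @ [last xs])" "Y \<in> set (butlast xs @ [last xs])"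
      using IH(1) Y by auto
    then show ?thesis by (auto simp: sorted_wrt_append)
  qed
  \<comment> \<open>Dominance gives the row below a ball in column \<open>Suc m\<close> or further
    right. By nesting, all lower rows then contain \<open>Suc m\<close>, so the counter is 0 on
    arrival at \<open>X\<close>, and a lone ball in column \<open>Suc m\<close> would be
    flipped.\<close>
  have down: "m \<in> X" if m: "1 \<le> m" "m < n" "Suc m \<in> X" for m
  proof -
    have "Suc m \<in> Y" if Y: "Y \<in> set xs" for Y
    proof -
      have "dominates n (last xs) X"
        using snoc.prems(1) Y by (auto simp: successively_append_iff)
      then obtain y where "y \<in> last xs" "Suc m \<le> y"
        using dominates_bound[of n "last xs" X "Suc m"] m by auto
      then have "{1..y} \<subseteq> Y" using last_sub[OF Y] IH(2) Y by blast
      then show ?thesis using \<open>Suc m \<le> y\<close> by auto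
    qed
    then have "fold (\<lambda>X k. upd m k X) xs 0 = 0" by (intro fold_upd_zero) auto
    then show ?thesis using fX[of m] m by (metis flip_left)
  qed
  have seg: "{1..x} \<subseteq> X" if "x \<in> X" for x
  proof
    fix y assume y: "y \<in> {1..x}"
    then have "y \<le> x" by simp
    then show "y \<in> X"
    proof (induction y rule: inc_induct)
      case (step z)
      then show ?case using down[of z] X y \<open>x \<in> X\<close> by (cases "z = 0") auto
    qed (use that in auto)
  qed
  have "X \<subseteq> Y" if Y: "Y \<in> set xs" for Y
  proof
    fix x assume x: "x \<in> X"
    have "dominates n (last xs) X"
      using snoc.prems(1) Y by (auto simp: successively_append_iff)
    moreover have x1: "1 \<le> x" "x \<le> n" using x X by auto
    ultimately obtain y where y: "y \<in> last xs" "x \<le> y"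
      using dominates_bound x by blast
    then have "{1..y} \<subseteq> Y" using last_sub[OF Y] IH(2) Y by blast
    then show "x \<in> Y" using x1 y by auto
  qed
  then show ?case using IH seg by (auto simp: sorted_wrt_append)
qed simp

lemma nested_mem_iff:
  "sorted_wrt (\<supseteq>) N \<Longrightarrow> r < length N \<Longrightarrow> c \<in> N ! r \<longleftrightarrow> r < col_weight c N"
proof (induction N arbitrary: r)
  case (Cons X N)
  show ?case
  proof (cases "c \<in> X")
    case True
    then show ?thesis using Cons by (cases r) auto
  next
    case False
    then have "\<forall>Y \<in> set N. c \<notin> Y" using Cons.prems by auto
    then have "col_weight c N = 0" by (simp add: col_weight_def filter_empty_conv)
    moreover have "c \<notin> (X # N) ! r"
      using \<open>\<forall>Y \<in> set N. c \<notin> Y\<close> False Cons.prems by (cases r) auto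
    ultimately show ?thesis using False by simp
  qed
qed simp

lemma nested_eqI:
  assumes "sorted_wrt (\<supseteq>) N" "sorted_wrt (\<supseteq>) N'" "length N = length N'"
    "\<And>c. col_weight c N = col_weight c N'"
  shows "N = N'"
  using assms(3,4) nested_mem_iff[OF assms(1)] nested_mem_iff[OF assms(2)]
  by (intro nth_equalityI set_eqI) auto

lemma nonwrapping_iff_lower_fixed:
  "nonwrapping n N \<longleftrightarrow> (\<forall>i. Suc i < length N \<longrightarrow> lower n i N = N)"
proof -
  have "lower n i N = N \<longleftrightarrow> unmatched n (N ! i) (N ! Suc i) = {}" if i: "Suc i < length N" for i
  proof
    assume "lower n i N = N"
    then have "lower n i N ! i = N ! i" by simp
    then show "unmatched n (N ! i) (N ! Suc i) = {}"
      using i unmatched_disjoint[of "N ! i" n "N ! Suc i"] by (auto simp: lower_def)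
  qed (simp add: lower_def)
  then show ?thesis by (simp add: successively_conv_nth dominates_iff)
qed

lemma nonwrapping_raise_col:
  assumes "1 \<le> m" "m < n" "nonwrapping n N"
  shows "nonwrapping n (raise_col m k N)"
  using assms(3) unfolding nonwrapping_iff_lower_fixed
  by (simp add: raise_col_lower[OF assms(1,2), symmetric])

abbreviation in_cols :: "nat \<Rightarrow> nat set list \<Rightarrow> bool" where
  "in_cols n N \<equiv> \<forall>X \<in> set N. X \<subseteq> {1..n}"

lemma in_cols_raise_col:
  "1 \<le> m \<Longrightarrow> m < n \<Longrightarrow> in_cols n N \<Longrightarrow> in_cols n (raise_col m k N)"
  by (induction N arbitrary: k) (auto simp: flip_def)

lemma in_cols_lower:
  assumes "in_cols n N" "Suc i < length N"
  shows "in_cols n (lower n i N)"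
proof
  fix X assume "X \<in> set (lower n i N)"
  then obtain r where r: "r < length N" "X = lower n i N ! r" by (metis in_set_conv_nth length_lower)
  have "N ! i \<subseteq> {1..n}" "N ! Suc i \<subseteq> {1..n}" "N ! r \<subseteq> {1..n}"
    using assms r by auto
  then show "X \<subseteq> {1..n}"
    using r assms(2) unmatched_subset[of n "N ! i" "N ! Suc i"]
    by (cases "r = i"; cases "r = Suc i") (auto simp: lower_def)
qed

lemma length_fold_lower [simp]: "length (fold (lower n) js N) = length N"
  by (induction js arbitrary: N) auto

lemma in_cols_fold_lower:
  "in_cols n N \<Longrightarrow> \<forall>i \<in> set js. Suc i < length N \<Longrightarrow> in_cols n (fold (lower n) js N)"
proof (induction js arbitrary: N)
  case (Cons i js)
  then show ?case using Cons.IH[OF in_cols_lower[of N n i]] by simp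
qed simp

text \<open>Supplies the measure for the descent in \<open>nonwrapping_unique\<close>: each flip
  lowers the sum of all column indices.\<close>

lemma sum_raise_col:
  assumes "in_cols n N"
  shows "(\<Sum>X\<leftarrow>raise_col m k N. \<Sum>X) \<le> (\<Sum>X\<leftarrow>N. \<Sum>X) \<and>
    (raise_col m k N \<noteq> N \<longrightarrow> (\<Sum>X\<leftarrow>raise_col m k N. \<Sum>X) < (\<Sum>X\<leftarrow>N. \<Sum>X))"
  using assms
proof (induction N arbitrary: k)
  case (Cons X N)
  have "\<Sum>(flip m k X) < \<Sum>X" if "flip m k X \<noteq> X"
  proof -
    have b: "m \<notin> X" "Suc m \<in> X" "flip m k X = insert m (X - {Suc m})"
      using that by (auto simp: flip_def split: if_splits)
    have "finite X" using Cons.prems by (meson finite_atLeastAtMost list.set_intros(1) rev_finite_subset)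
    then show ?thesis using b sum.remove[of X "Suc m" "\<lambda>x. x"] by simp
  qed
  moreover have "in_cols n N" using Cons.prems by simp
  ultimately show ?case
    using Cons.IH[of "upd m k X"] by (cases "flip m k X = X") (auto intro: add_less_le_mono)
qed simp

text \<open>Raising operators commute with the lowering operators and are injective for given column sums, so
  applying them to \<open>M\<close> reduces to the case where \<open>M\<close> is fixed by all of them.\<close>

lemma nonwrapping_unique:
  assumes "in_cols n M" "\<forall>i \<in> set js. Suc i < length M" "\<forall>i \<in> set ks. Suc i < length M"
    "nonwrapping n (fold (lower n) js M)" "nonwrapping n (fold (lower n) ks M)"
  shows "fold (lower n) js M = fold (lower n) ks M"
  using assms
proof (induction "\<Sum>X\<leftarrow>M. \<Sum>X" arbitrary: M rule: less_induct)
  case less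
  let ?P = "fold (lower n) js" and ?Q = "fold (lower n) ks"
  show ?case
  proof (cases "\<exists>m. 1 \<le> m \<and> m < n \<and> raise_col m 0 M \<noteq> M")
    case True
    then obtain m where m: "1 \<le> m" "m < n" "raise_col m 0 M \<noteq> M" by blast
    have comm: "raise_col m 0 (?P M) = ?P (raise_col m 0 M)" "raise_col m 0 (?Q M) = ?Q (raise_col m 0 M)"
      by (rule raise_col_fold_lower[OF m(1,2)]; fact)+
    have "?P (raise_col m 0 M) = ?Q (raise_col m 0 M)"
    proof (rule less.hyps)
      show "(\<Sum>X\<leftarrow>raise_col m 0 M. \<Sum>X) < (\<Sum>X\<leftarrow>M. \<Sum>X)"
        using sum_raise_col[OF less.prems(1), of m 0] m by blast
      show "in_cols n (raise_col m 0 M)" using in_cols_raise_col[OF m(1,2) less.prems(1)] .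
      show "nonwrapping n (?P (raise_col m 0 M))" "nonwrapping n (?Q (raise_col m 0 M))"
        using nonwrapping_raise_col[OF m(1,2)] less.prems unfolding comm[symmetric] by blast+
    qed (use less.prems in auto)
    then have "raise_col m 0 (?P M) = raise_col m 0 (?Q M)" using comm by simp
    moreover have "col_weight m (?P M) = col_weight m (?Q M)"
      using col_weight_fold_lower less.prems by simp
    ultimately show ?thesis by (rule raise_col_inj)
  next
    case False
    have fixed: "raise_col m 0 (?P M) = ?P M" "raise_col m 0 (?Q M) = ?Q M" if "1 \<le> m" "m < n" for m
      using raise_col_fold_lower[OF that less.prems(2), of 0]
        raise_col_fold_lower[OF that less.prems(3), of 0] False that by simp_all
    have "sorted_wrt (\<supseteq>) (?P M)"
      using raise_fixed_nested[OF less.prems(4) in_cols_fold_lower[OF less.prems(1,2)]] fixed by simp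
    moreover have "sorted_wrt (\<supseteq>) (?Q M)"
      using raise_fixed_nested[OF less.prems(5) in_cols_fold_lower[OF less.prems(1,3)]] fixed by simp
    ultimately show ?thesis
      using less.prems(2,3) by (intro nested_eqI) (simp_all add: col_weight_fold_lower)
  qed
qed


section \<open>Pairing of two rows as a flow on the circle\<close>

text \<open>\<open>p c\<close> counts the upper balls (set \<open>A\<close>) that travel from column \<open>c\<close> to column \<open>c + 1\<close> when they are
  paired with the balls \<open>S\<close> of the lower row \<open>B\<close>; the crossing from column \<open>n\<close> to column \<open>1\<close> is both
  \<open>p n\<close> and \<open>p 0\<close>. A lower ball stays unpaired only if nothing arrives at its column.\<close>

definition flow :: "nat \<Rightarrow> nat set \<Rightarrow> nat set \<Rightarrow> nat set \<Rightarrow> (nat \<Rightarrow> nat) \<Rightarrow> bool" where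
  "flow n A B S p \<longleftrightarrow> p 0 = p n \<and> S \<subseteq> B \<and>
     (\<forall>c < n. p (Suc c) + of_bool (Suc c \<in> S) = p c + of_bool (Suc c \<in> A)) \<and>
     (\<forall>c < n. Suc c \<in> B \<and> Suc c \<notin> S \<longrightarrow> p (Suc c) = 0)"

lemma flow_step:
  "flow n A B S p \<Longrightarrow> c < n \<Longrightarrow> p (Suc c) + of_bool (Suc c \<in> S) = p c + of_bool (Suc c \<in> A)"
  by (simp add: flow_def)

lemma flow_unpaired:
  assumes "flow n A B S p" "c < n" "Suc c \<in> B" "Suc c \<notin> S"
  shows "p (Suc c) = 0" "p c = 0" "Suc c \<notin> A"
  using assms flow_step[OF assms(1,2)] by (auto simp: flow_def)

text \<open>Going right, the distance between the two flows never grows, and it drops strictly where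
  \<open>S\<close> and \<open>S'\<close> disagree: there one of the flows is 0 on both sides of the
  column. After a full turn the distance must be the same again, so there is no
  disagreement.\<close>

lemma flow_unique:
  assumes "flow n A B S p" "flow n A B S' p'" "B \<subseteq> {1..n}"
  shows "S = S'"
proof (rule ccontr)
  assume "S \<noteq> S'"
  define D where "D = (\<lambda>c. \<bar>int (p c) - int (p' c)\<bar>)"
  have decr: "D (Suc c) \<le> D c \<and> ((Suc c \<in> S) \<noteq> (Suc c \<in> S') \<longrightarrow> D (Suc c) < D c)" if "c < n" for c
  proof -
    have sub: "S \<subseteq> B" "S' \<subseteq> B" using assms by (simp_all add: flow_def)
    note eqs = flow_step[OF assms(1) that] flow_step[OF assms(2) that]
    consider "(Suc c \<in> S) = (Suc c \<in> S')" | "Suc c \<in> S" "Suc c \<notin> S'" | "Suc c \<notin> S" "Suc c \<in> S'"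
      by blast
    then show ?thesis
    proof cases
      case 1
      then have "int (p (Suc c)) - int (p' (Suc c)) = int (p c) - int (p' c)"
        using eqs by simp
      then show ?thesis using 1 by (simp add: D_def)
    next
      case 2
      then have "Suc c \<in> B" using sub by blast
      then show ?thesis using 2 eqs flow_unpaired[OF assms(2) that] by (simp add: D_def)
    next
      case 3
      then have "Suc c \<in> B" using sub by blast
      then show ?thesis using 3 eqs flow_unpaired[OF assms(1) that] by (simp add: D_def)
    qed
  qed
  have mono: "D y \<le> D x" if "x \<le> y" "y \<le> n" for x y
    using that
  proof (induction y rule: dec_induct)
    case (step z)
    then show ?case using decr[of z] by simp
  qed simp
  obtain c where c: "(c \<in> S) \<noteq> (c \<in> S')" "1 \<le> c" "c \<le> n"
    using \<open>S \<noteq> S'\<close> assms unfolding flow_def by fastforce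
  then obtain c' where c': "c = Suc c'" by (cases c) auto
  have "D n \<le> D c" "D c < D c'" "D c' \<le> D 0" using mono decr c c' by auto
  moreover have "D 0 = D n" using assms by (simp add: D_def flow_def)
  ultimately show False by simp
qed

text \<open>From here on the first argument of \<open>suf\<close> varies, so that
  \<open>suf y X x\<close> counts balls in an arbitrary interval \<open>{x..y}\<close>.\<close>

lemma suf_interval_Suc:
  "x \<le> Suc y \<Longrightarrow> suf (Suc y) X x = suf y X x + of_bool (Suc y \<in> X)"
proof -
  assume "x \<le> Suc y"
  then have "{x..Suc y} = insert (Suc y) {x..y}" by auto
  then show ?thesis by (simp add: suf_def)
qed

lemma flow_interval:
  assumes "flow n A B S p" "x \<le> y" "y \<le> n"
  shows "p y + suf y S (Suc x) = p x + suf y A (Suc x)"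
  using assms(2,3)
proof (induction y rule: dec_induct)
  case (step y)
  then show ?case
    using flow_step[OF assms(1), of y] suf_interval_Suc[of "Suc x" y S] suf_interval_Suc[of "Suc x" y A]
    by simp
qed simp

text \<open>\<open>x\<close> starts the busy period that contains \<open>c\<close>: nothing crosses
  into column \<open>x\<close>, and from \<open>x\<close> to \<open>c\<close> the flow stays
  positive, so every lower ball in between is paired. Such a start exists because nothing crosses
  into column 1.\<close>

lemma flow_positive:
  assumes "flow n A B S p" "p 0 = 0" "c \<le> n" "0 < p c"
  obtains x where "1 \<le> x" "x \<le> c" "suf c A x = p c + suf c B x"
proof -
  have "\<exists>x. 1 \<le> x \<and> x \<le> c \<and> suf c A x = p c + suf c B x"
    using assms(3,4)
  proof (induction c)
    case (Suc c)
    have SB: "Suc c \<in> S \<longleftrightarrow> Suc c \<in> B" using Suc.prems assms(1) by (auto simp: flow_def Suc_le_eq)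
    note step = flow_step[OF assms(1), of c]
    show ?case
    proof (cases "p c = 0")
      case True
      then show ?thesis
        using step Suc.prems SB by (intro exI[of _ "Suc c"]) (simp add: suf_interval_Suc)
    next
      case False
      then obtain x where "1 \<le> x" "x \<le> c" "suf c A x = p c + suf c B x" using Suc by auto
      then show ?thesis
        using step Suc.prems SB by (intro exI[of _ x]) (simp add: suf_interval_Suc)
    qed
  qed (use assms in simp)
  then show ?thesis using that by blast
qed

primrec lin_pend :: "nat set \<Rightarrow> nat set \<Rightarrow> nat \<Rightarrow> nat" where
  "lin_pend A B 0 = 0"
| "lin_pend A B (Suc c) = lin_pend A B c + of_bool (Suc c \<in> A) - of_bool (Suc c \<in> B)"

text \<open>Run the queue from the left, starting empty. Balls left over at column \<open>n\<close>
  would give a busy period with more upper than lower balls in \<open>{x..n}\<close>, against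
  dominance. So the linear run closes up to a flow on the circle.\<close>

lemma flow_nonwrapping:
  assumes "dominates n B A"
  obtains S p where "flow n A B S p" "p 0 = 0"
proof -
  let ?p = "lin_pend A B"
  let ?S = "{c \<in> B. c \<in> A \<or> 0 < ?p (c - 1)}"
  have "flow n A B ?S (?p(n := 0))" if "?p n = 0 \<or> n = 0"
  proof -
    have "?p(n := 0) = ?p" using that by (cases n) auto
    then show ?thesis using that by (auto simp: flow_def)
  qed
  moreover have "?p n = 0"
  proof (rule ccontr)
    assume "?p n \<noteq> 0"
    then obtain x where "1 \<le> x" "x \<le> n" "suf n A x = ?p n + suf n B x"
    proof -
      have "0 < ?p c \<Longrightarrow> \<exists>x. 1 \<le> x \<and> x \<le> c \<and> suf c A x = ?p c + suf c B x" for c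
      proof (induction c)
        case (Suc c)
        show ?case
        proof (cases "?p c = 0")
          case True
          then show ?thesis
            using Suc.prems by (intro exI[of _ "Suc c"]) (auto simp: suf_interval_Suc split: if_splits)
        next
          case False
          then obtain x where "1 \<le> x" "x \<le> c" "suf c A x = ?p c + suf c B x" using Suc by auto
          then show ?thesis
            using Suc.prems by (intro exI[of _ x]) (simp add: suf_interval_Suc)
        qed
      qed simp
      then show ?thesis using that \<open>?p n \<noteq> 0\<close> by auto
    qed
    then show False using assms \<open>?p n \<noteq> 0\<close> by (fastforce simp: dominates_def)
  qed
  moreover have "(?p(n := 0)) 0 = 0" by simp
  ultimately show ?thesis using that by blast
qed

text \<open>Unfolds the truncated recursion into a running maximum: the pending count is the largest
  excess of \<open>A\<close> over \<open>B\<close> in an interval starting at \<open>Suc c\<close>.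
  The empty interval, \<open>d = c\<close>, accounts for the truncation at 0.\<close>

lemma pend_le_iff:
  assumes "c \<le> n"
  shows "pend n A B c \<le> k \<longleftrightarrow> (\<forall>d \<in> {c..n}. suf d A (Suc c) \<le> suf d B (Suc c) + k)"
  using assms
proof (induction c arbitrary: k rule: inc_induct)
  case (step c)
  let ?a = "of_bool (Suc c \<in> A) :: nat" and ?b = "of_bool (Suc c \<in> B) :: nat"
  have eq: "suf d X (Suc c) = of_bool (Suc c \<in> X) + suf d X (Suc (Suc c))" if "Suc c \<le> d" for d X
    using suf_step that by simp
  have "pend n A B c \<le> k \<longleftrightarrow> ?a \<le> k + ?b \<and> pend n A B (Suc c) \<le> k + ?b - ?a"
    using pend_step[of c n A B] step.hyps by auto
  also have "\<dots> \<longleftrightarrow> ?a \<le> k + ?b \<and>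
      (\<forall>d \<in> {Suc c..n}. suf d A (Suc (Suc c)) \<le> suf d B (Suc (Suc c)) + (k + ?b - ?a))"
    by (simp only: step.IH)
  also have "\<dots> \<longleftrightarrow> (\<forall>d \<in> {Suc c..n}. suf d A (Suc c) \<le> suf d B (Suc c) + k)" (is "?L \<longleftrightarrow> ?R")
  proof
    assume ?L
    then show ?R using eq by fastforce
  next
    assume R: ?R
    then have "suf (Suc c) A (Suc c) \<le> suf (Suc c) B (Suc c) + k" using step by auto
    then have "?a \<le> k + ?b" using eq[of "Suc c"] by simp
    then show ?L using R eq by fastforce
  qed
  also have "\<dots> \<longleftrightarrow> (\<forall>d \<in> {c..n}. suf d A (Suc c) \<le> suf d B (Suc c) + k)" (is "?L \<longleftrightarrow> ?R")
  proof
    assume L: ?L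
    show ?R
    proof
      fix d assume "d \<in> {c..n}"
      then show "suf d A (Suc c) \<le> suf d B (Suc c) + k" using L by (cases "d = c") auto
    qed
  qed auto
  finally show ?case .
qed simp

lemma unmatched_iff:
  "c \<in> unmatched n A B \<longleftrightarrow> c \<in> B \<and> 1 \<le> c \<and> c \<le> n \<and> (\<forall>d \<in> {c..n}. suf d A c < suf d B c)"
proof (cases "c \<in> B \<and> 1 \<le> c \<and> c \<le> n")
  case True
  have eq: "suf d X c = of_bool (c \<in> X) + suf d X (Suc c)" if "c \<le> d" for d X
    using suf_step that by simp
  have "c \<in> unmatched n A B \<longleftrightarrow> c \<notin> A \<and> (\<forall>d \<in> {c..n}. suf d A (Suc c) \<le> suf d B (Suc c))"
    using True pend_le_iff[of c n A B 0] by (auto simp: unmatched_def)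
  also have "\<dots> \<longleftrightarrow> (\<forall>d \<in> {c..n}. suf d A c < suf d B c)" (is "?L \<longleftrightarrow> ?R")
  proof
    assume ?L
    then show ?R using eq True by fastforce
  next
    assume R: ?R
    then have "suf c A c < suf c B c" using True by auto
    then have "c \<notin> A" using eq[of c] True by (auto split: if_splits)
    then show ?L using R eq True by fastforce
  qed
  finally show ?thesis using True by simp
qed (auto simp: unmatched_def)

text \<open>Exchanging the sizes of two rows by moving the unpaired lower balls up (the combinatorial
  \<open>R\<close>-matrix) is the Weyl group reflection of the row crystal: it stays on the same string.\<close>

lemma unmatched_reflect:
  assumes f: "flow n A B S p" and B: "B \<subseteq> {1..n}"
  shows "unmatched n S (A \<union> (B - S)) = unmatched n B A \<union> (B - S)"
proof (rule set_eqI)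
  fix c
  let ?T = "B - S"
  have SB: "S \<subseteq> B" using f by (simp add: flow_def)
  have T: "c \<notin> A \<and> p (c - 1) = 0" if c: "c \<in> ?T" for c
  proof -
    have "1 \<le> c" "c \<le> n" using c B by auto
    then show ?thesis using flow_unpaired[OF f, of "c - 1"] c by simp
  qed
  have cB: "suf d B c = suf d S c + suf d ?T c" for d
    using suf_diff[OF SB, of d c] by simp
  have "A \<inter> ?T = {}" using T by blast
  then have cA: "suf d (A \<union> ?T) c = suf d A c + suf d ?T c" for d by (rule suf_union)
  have tele: "p d + suf d S c = p (c - 1) + suf d A c" if "1 \<le> c" "c \<le> d" "d \<le> n" for d
    using flow_interval[OF f, of "c - 1" d] that by simp
  have "c \<in> unmatched n S (A \<union> ?T)" if "c \<in> unmatched n B A"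
    using that by (force simp: unmatched_iff cB cA)
  moreover have "c \<in> unmatched n S (A \<union> ?T)" if c: "c \<in> ?T"
  proof -
    have "0 < suf d ?T c" if "c \<le> d" for d using c that by (auto simp: suf_step)
    moreover have "1 \<le> c" "c \<le> n" using c B by auto
    moreover have "p (c - 1) = 0" using T c by blast
    ultimately show ?thesis unfolding unmatched_iff cA using c tele by fastforce
  qed
  moreover have "c \<in> unmatched n B A" if c: "c \<in> unmatched n S (A \<union> ?T)" "c \<notin> ?T"
  proof -
    have cc: "1 \<le> c" "c \<le> n" "c \<in> A" using c by (auto simp: unmatched_def)
    have lt: "p (c - 1) < p d + suf d ?T c" if "c \<le> d" "d \<le> n" for d
      using c tele[of d] that cc by (force simp: unmatched_iff cA)
    \<comment> \<open>At the first unpaired ball \<open>t\<close> right of \<open>c\<close> nothing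
      arrives, so \<open>lt\<close> would fail at \<open>d = t - 1\<close>; \<open>c < t\<close>
      holds because \<open>c \<in> A\<close> and \<open>t \<notin> A\<close>.\<close>
    have no: "?T \<inter> {c..n} = {}"
    proof (rule ccontr)
      assume ne: "?T \<inter> {c..n} \<noteq> {}"
      define t where "t = Min (?T \<inter> {c..n})"
      have t: "t \<in> ?T \<inter> {c..n}" unfolding t_def using ne by (intro Min_in) auto
      have "?T \<inter> {c..t - 1} = {}"
      proof (rule ccontr)
        assume "?T \<inter> {c..t - 1} \<noteq> {}"
        then obtain s where "s \<in> ?T \<inter> {c..t - 1}" by blast
        then have s: "s \<in> ?T" "c \<le> s" "s \<le> t - 1" by simp_all
        then have "s \<in> ?T \<inter> {c..n}" using t by auto
        then have "t \<le> s" unfolding t_def by (intro Min_le) auto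
        then show False using s cc by simp
      qed
      then have "suf (t - 1) ?T c = 0" by (simp add: suf_def)
      moreover have "c < t" using t cc T by (metis IntD1 IntD2 atLeastAtMost_iff le_neq_implies_less)
      moreover have "p (t - 1) = 0" "t - 1 \<le> n" using T t by auto
      moreover have "c \<le> t - 1" using \<open>c < t\<close> by simp
      ultimately show False using lt[of "t - 1"] by simp
    qed
    have "suf d ?T c = 0" if "d \<le> n" for d
    proof -
      have "?T \<inter> {c..d} = {}" using no that by auto
      then show ?thesis by (simp add: suf_def)
    qed
    then show ?thesis using c cc by (auto simp: unmatched_iff cB cA)
  qed
  ultimately show "c \<in> unmatched n S (A \<union> ?T) \<longleftrightarrow> c \<in> unmatched n B A \<union> ?T" by blast
qed

text \<open>The balls \<open>B - S\<close> that were moved up are exactly the additional ones that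
  the operator brings down again.\<close>

lemma lower_reflect:
  assumes f: "flow n A B S p" and B: "B \<subseteq> {1..n}"
  shows "lower n 0 (S # (A \<union> (B - S)) # r) = lower n 0 (B # A # r)"
proof -
  have "A \<inter> (B - S) = {}"
  proof -
    have "c \<notin> A" if c: "c \<in> B - S" for c
    proof -
      have "1 \<le> c" "c \<le> n" using c B by auto
      then show ?thesis using flow_unpaired(3)[OF f, of "c - 1"] c by simp
    qed
    then show ?thesis by blast
  qed
  moreover have "S \<subseteq> B" using f by (simp add: flow_def)
  ultimately show ?thesis unfolding lower_0 unmatched_reflect[OF f B] by auto
qed

section \<open>The greedy cyclic pairing as a flow\<close>

lemma find_upt_iff:
  "find P [a..<b] = Some d \<longleftrightarrow> a \<le> d \<and> d < b \<and> P d \<and> (\<forall>e. a \<le> e \<and> e < d \<longrightarrow> \<not> P e)"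
proof (induction "b - a" arbitrary: a)
  case 0
  then have "b \<le> a" by simp
  then show ?case by auto
next
  case (Suc k)
  have "a < b" using Suc(2) by simp
  have IH: "find P [Suc a..<b] = Some d \<longleftrightarrow>
      Suc a \<le> d \<and> d < b \<and> P d \<and> (\<forall>e. Suc a \<le> e \<and> e < d \<longrightarrow> \<not> P e)"
    by (rule Suc(1)) (use Suc(2) in simp)
  have s: "find P [a..<b] = (if P a then Some a else find P [Suc a..<b])"
    using \<open>a < b\<close> by (simp add: upt_conv_Cons)
  show ?case
  proof (cases "P a")
    case True
    have "find P [a..<b] = Some d \<longleftrightarrow> a = d" using s True by simp
    also have "\<dots> \<longleftrightarrow> a \<le> d \<and> d < b \<and> P d \<and> (\<forall>e. a \<le> e \<and> e < d \<longrightarrow> \<not> P e)"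
      using True \<open>a < b\<close> by (metis le_neq_implies_less order_refl leD)
    finally show ?thesis .
  next
    case False
    have "find P [a..<b] = Some d \<longleftrightarrow> find P [Suc a..<b] = Some d" using s False by simp
    also note IH
    also have "Suc a \<le> d \<and> d < b \<and> P d \<and> (\<forall>e. Suc a \<le> e \<and> e < d \<longrightarrow> \<not> P e) \<longleftrightarrow>
      a \<le> d \<and> d < b \<and> P d \<and> (\<forall>e. a \<le> e \<and> e < d \<longrightarrow> \<not> P e)"
      using False by (metis Suc_leI Suc_leD le_neq_implies_less)
    finally show ?thesis .
  qed
qed

lemma find_append:
  "find P (xs @ ys) = (case find P xs of None \<Rightarrow> find P ys | Some x \<Rightarrow> Some x)"
  by (induction xs) auto

text \<open>The new ball travels from \<open>x\<close> to \<open>d\<close> and adds one to the flow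
  along this arc. Since \<open>d\<close> is the first free site, the arc passes no lower ball that
  stays unpaired.\<close>

lemma flow_insert:
  assumes f: "flow n A B {c. g c \<noteq> 0} p" and x: "1 \<le> x" "x \<le> n" "x \<notin> A"
    and d: "first_unpaired n B g x = Some d"
  shows "d \<in> B" "g d = 0" "1 \<le> d"
    and "\<exists>p'. flow n (insert x A) B (insert d {c. g c \<noteq> 0}) p'"
proof -
  let ?P = "\<lambda>d. d \<in> B \<and> g d = 0"
  have none: "find ?P [x..<Suc n] = None \<longleftrightarrow> (\<forall>e. x \<le> e \<and> e \<le> n \<longrightarrow> \<not> ?P e)"
    by (auto simp: find_None_iff simp del: upt_Suc)
  have "find ?P [x..<Suc n] = Some d \<or> find ?P [x..<Suc n] = None \<and> find ?P [1..<x] = Some d"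
    using d unfolding first_unpaired_def find_append by (auto split: option.splits)
  then consider (right) "x \<le> d" "d \<le> n" "?P d" "\<And>e. x \<le> e \<Longrightarrow> e < d \<Longrightarrow> \<not> ?P e"
    | (wrap) "1 \<le> d" "d < x" "?P d" "\<And>e. x \<le> e \<Longrightarrow> e \<le> n \<Longrightarrow> \<not> ?P e"
        "\<And>e. 1 \<le> e \<Longrightarrow> e < d \<Longrightarrow> \<not> ?P e"
    unfolding find_upt_iff none by fastforce
  then have "d \<in> B \<and> g d = 0 \<and> 1 \<le> d \<and> (\<exists>p'. flow n (insert x A) B (insert d {c. g c \<noteq> 0}) p')"
  proof cases
    case right
    have "flow n (insert x A) B (insert d {c. g c \<noteq> 0}) (\<lambda>e. p e + of_bool (x \<le> e \<and> e < d))"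
      unfolding flow_def
    proof (intro conjI allI impI)
      fix c assume "c < n"
      then show "p (Suc c) + of_bool (x \<le> Suc c \<and> Suc c < d) + of_bool (Suc c \<in> insert d {c. g c \<noteq> 0})
          = p c + of_bool (x \<le> c \<and> c < d) + of_bool (Suc c \<in> insert x A)"
        using flow_step[OF f, of c] right x by (cases "Suc c = x"; cases "Suc c = d") auto
    next
      fix c assume c: "c < n" "Suc c \<in> B \<and> Suc c \<notin> insert d {c. g c \<noteq> 0}"
      then have "\<not> (x \<le> Suc c \<and> Suc c < d)" using right(4)[of "Suc c"] by auto
      then show "p (Suc c) + of_bool (x \<le> Suc c \<and> Suc c < d) = 0"
        using c flow_unpaired(1)[OF f, of c] by simp
    qed (use f right x in \<open>auto simp: flow_def\<close>)
    then show ?thesis using right x by auto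
  next
    case wrap
    \<comment> \<open>The arc now crosses from column \<open>n\<close> to column 1. Both
      \<open>e = n\<close> and \<open>e = 0\<close> lie on it, which keeps
      \<open>p 0 = p n\<close>.\<close>
    have "flow n (insert x A) B (insert d {c. g c \<noteq> 0}) (\<lambda>e. p e + of_bool (x \<le> e \<or> e < d))"
      unfolding flow_def
    proof (intro conjI allI impI)
      fix c assume "c < n"
      then show "p (Suc c) + of_bool (x \<le> Suc c \<or> Suc c < d) + of_bool (Suc c \<in> insert d {c. g c \<noteq> 0})
          = p c + of_bool (x \<le> c \<or> c < d) + of_bool (Suc c \<in> insert x A)"
        using flow_step[OF f, of c] wrap x by (cases "Suc c = x"; cases "Suc c = d") auto
    next
      fix c assume c: "c < n" "Suc c \<in> B \<and> Suc c \<notin> insert d {c. g c \<noteq> 0}"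
      then have "\<not> (x \<le> Suc c \<or> Suc c < d)" using wrap(4,5)[of "Suc c"] by auto
      then show "p (Suc c) + of_bool (x \<le> Suc c \<or> Suc c < d) = 0"
        using c flow_unpaired(1)[OF f, of c] by simp
    qed (use f wrap x in \<open>auto simp: flow_def\<close>)
    then show ?thesis using wrap by auto
  qed
  then show "d \<in> B" "g d = 0" "1 \<le> d" "\<exists>p'. flow n (insert x A) B (insert d {c. g c \<noteq> 0}) p'" by auto
qed

text \<open>Balls with labels \<open>>= k\<close> come first in the order, and later balls never
  change a site already taken. So the sites with labels \<open>>= k\<close> are what these balls
  alone would reach. The bound on \<open>length cs\<close> guarantees a free site for each
  ball.\<close>

lemma fold_pair_ball:
  assumes "B \<subseteq> {1..n}" "sorted_wrt (\<lambda>x y. f y \<le> f x) cs" "distinct cs"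
    "\<forall>x \<in> set cs. f x \<noteq> 0 \<and> 1 \<le> x \<and> x \<le> n" "length cs \<le> card B"
  defines "g \<equiv> fold (pair_ball n B f) cs (\<lambda>_. 0)"
  shows "(\<forall>k \<ge> 1. \<exists>p. flow n {c \<in> set cs. k \<le> f c} B {c. k \<le> g c} p) \<and>
    {c. g c \<noteq> 0} \<subseteq> B \<and> (\<forall>c. g c \<noteq> 0 \<longrightarrow> (\<exists>x \<in> set cs. g c = f x)) \<and>
    card {c. g c \<noteq> 0} = length cs"
  using assms(2-5) unfolding g_def
proof (induction cs rule: rev_induct)
  case Nil
  have "flow n {} B {} (\<lambda>_. 0)" by (simp add: flow_def)
  then show ?case by auto
next
  case (snoc x cs)
  define g where "g = fold (pair_ball n B f) cs (\<lambda>_. 0)"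
  have IH: "\<And>k. 1 \<le> k \<Longrightarrow> \<exists>p. flow n {c \<in> set cs. k \<le> f c} B {c. k \<le> g c} p"
      "{c. g c \<noteq> 0} \<subseteq> B" "\<And>c. g c \<noteq> 0 \<Longrightarrow> \<exists>x \<in> set cs. g c = f x" "card {c. g c \<noteq> 0} = length cs"
    using snoc by (auto simp: g_def sorted_wrt_append)
  have fin: "finite B" using assms(1) finite_subset by blast
  have x: "f x \<noteq> 0" "1 \<le> x" "x \<le> n" "x \<notin> set cs" using snoc by auto
  have ge: "f x \<le> f y" if "y \<in> set cs" for y using snoc that by (auto simp: sorted_wrt_append)
  have "{c. g c \<noteq> 0} \<noteq> B" using IH(4) snoc.prems(4) by auto
  then obtain e where "e \<in> B" "g e = 0" using IH(2) by blast
  moreover have "e \<in> set ([x..<Suc n] @ [1..<x])" if "e \<in> B" for e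
    using that assms(1) by (auto simp del: upt_Suc)
  ultimately have "first_unpaired n B g x \<noteq> None"
    unfolding first_unpaired_def find_None_iff by blast
  then obtain d where d: "first_unpaired n B g x = Some d" by blast
  then have g': "fold (pair_ball n B f) (cs @ [x]) (\<lambda>_. 0) = g(d := f x)"
    by (simp add: g_def pair_ball_def)
  have ge': "f x \<le> g c" if "g c \<noteq> 0" for c using IH(3)[OF that] ge by auto
  have A: "{c \<in> set cs. k \<le> f c} = set cs \<and> {c. k \<le> g c} = {c. g c \<noteq> 0}" if "1 \<le> k" "k \<le> f x" for k
  proof -
    have "k \<le> g c \<longleftrightarrow> g c \<noteq> 0" for c using ge'[of c] that by auto
    moreover have "k \<le> f c" if "c \<in> set cs" for c using ge[OF that] \<open>k \<le> f x\<close> by simp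
    ultimately show ?thesis by auto
  qed
  have one: "1 \<le> f x" using x by simp
  obtain p where "flow n (set cs) B {c. g c \<noteq> 0} p"
    using IH(1)[of 1] A[of 1] one by auto
  note ins = flow_insert[OF this x(2,3,4) d]
  have "\<exists>p. flow n {c \<in> set (cs @ [x]). k \<le> f c} B {c. k \<le> (g(d := f x)) c} p" if k: "1 \<le> k" for k
  proof (cases "k \<le> f x")
    case True
    have "k \<le> f c" if "c \<in> set cs" for c using ge[OF that] True by simp
    then have "{c \<in> set (cs @ [x]). k \<le> f c} = insert x (set cs)" using True by auto
    moreover have "{c. k \<le> (g(d := f x)) c} = insert d {c. g c \<noteq> 0}"
      using A[OF k True] True by auto
    ultimately show ?thesis using ins(4) by simp
  next
    case False
    then have "{c \<in> set (cs @ [x]). k \<le> f c} = {c \<in> set cs. k \<le> f c}" by auto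
    moreover have "{c. k \<le> (g(d := f x)) c} = {c. k \<le> g c}" using False ins(2) k by auto
    ultimately show ?thesis using IH(1)[OF k] by simp
  qed
  moreover have "{c. (g(d := f x)) c \<noteq> 0} = insert d {c. g c \<noteq> 0}" using x by auto
  moreover have "card (insert d {c. g c \<noteq> 0}) = Suc (length cs)"
    using ins(2) IH(2,4) fin by (simp add: finite_subset)
  moreover have "insert d {c. g c \<noteq> 0} \<subseteq> B" using IH(2) ins(1) by simp
  moreover have "\<exists>y \<in> set (cs @ [x]). (g(d := f x)) c = f y" if "(g(d := f x)) c \<noteq> 0" for c
    using that IH(3)[of c] by (cases "c = d") auto
  ultimately show ?case unfolding g' by simp
qed

lemma pairing_order_props:
  assumes "{c. f c \<noteq> 0} \<subseteq> {1..n}"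
  shows "set (pairing_order n f) = {c. f c \<noteq> 0}" "distinct (pairing_order n f)"
    "sorted_wrt (\<lambda>x y. f y \<le> f x) (pairing_order n f)"
proof -
  have "sorted (map (\<lambda>c. - int (f c)) (pairing_order n f))"
    unfolding pairing_order_def by (rule sorted_sort_key)
  then show "sorted_wrt (\<lambda>x y. f y \<le> f x) (pairing_order n f)"
    by (simp add: sorted_map)
  show "distinct (pairing_order n f)" by (simp add: pairing_order_def del: upt_Suc)
  show "set (pairing_order n f) = {c. f c \<noteq> 0}"
    using assms by (auto simp: pairing_order_def simp del: upt_Suc)
qed


section \<open>Level sets of the labelling\<close>

abbreviation shrinking :: "nat set list \<Rightarrow> bool" where
  "shrinking \<equiv> successively (\<lambda>X Y. card Y \<le> card X)"

definition level :: "nat \<Rightarrow> nat \<Rightarrow> nat set list \<Rightarrow> nat \<Rightarrow> nat set" where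
  "level n r Bs k = {c. k \<le> fm_labels n r Bs c}"

lemma level_antimono: "k \<le> k' \<Longrightarrow> level n r Bs k' \<subseteq> level n r Bs k"
  by (auto simp: level_def)

lemma label_row:
  assumes "X \<subseteq> {1..n}" "{c. f c \<noteq> 0} \<subseteq> {1..n}" "card {c. f c \<noteq> 0} \<le> card X" "1 \<le> r"
    "\<forall>c. f c \<noteq> 0 \<longrightarrow> Suc r \<le> f c"
  defines "h \<equiv> label_rest r X (pair_rows n X f)"
  shows "\<forall>c. h c \<noteq> 0 \<longrightarrow> r \<le> h c" "{c. h c \<noteq> 0} = X"
    "\<And>k. r < k \<Longrightarrow> \<exists>p. flow n {c. k \<le> f c} X {c. k \<le> h c} p"
proof -
  let ?cs = "pairing_order n f" and ?g = "pair_rows n X f"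
  note po = pairing_order_props[OF assms(2)]
  have cond: "\<forall>x \<in> set ?cs. f x \<noteq> 0 \<and> 1 \<le> x \<and> x \<le> n" unfolding po(1) using assms(2) by auto
  have len: "length ?cs \<le> card X"
    using assms(3) distinct_card[OF po(2)] unfolding po(1) by simp
  note F = fold_pair_ball[OF assms(1) po(3,2) cond len, folded pair_rows_def]
  have gX: "{c. ?g c \<noteq> 0} \<subseteq> X" using F by blast
  have gr: "Suc r \<le> ?g c" if g: "?g c \<noteq> 0" for c
  proof -
    obtain x where "x \<in> set ?cs" "?g c = f x" using F g by blast
    then show ?thesis using assms(5) g by metis
  qed
  show "\<forall>c. h c \<noteq> 0 \<longrightarrow> r \<le> h c"
  proof (intro allI impI)
    fix c assume "h c \<noteq> 0"
    then show "r \<le> h c" using gr[of c] by (cases "?g c = 0") (auto simp: h_def label_rest_def)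
  qed
  show "{c. h c \<noteq> 0} = X" using gX assms(4) by (auto simp: h_def label_rest_def)
  fix k assume k: "r < k"
  have "{c. k \<le> h c} = {c. k \<le> ?g c}" using k by (auto simp: h_def label_rest_def)
  moreover have "{c \<in> set ?cs. k \<le> f c} = {c. k \<le> f c}" unfolding po(1) using k by auto
  moreover have "\<exists>p. flow n {c \<in> set ?cs. k \<le> f c} X {c. k \<le> ?g c} p" using F k by auto
  ultimately show "\<exists>p. flow n {c. k \<le> f c} X {c. k \<le> h c} p" by simp
qed

lemma fm_labels_props:
  assumes "in_cols n Bs" "shrinking Bs" "1 \<le> r"
  shows "(\<forall>c. fm_labels n r Bs c \<noteq> 0 \<longrightarrow> r \<le> fm_labels n r Bs c) \<and>
    {c. fm_labels n r Bs c \<noteq> 0} = (case Bs of [] \<Rightarrow> {} | X # _ \<Rightarrow> X)"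
  using assms
proof (induction Bs arbitrary: r)
  case (Cons X Bs)
  let ?f = "fm_labels n (Suc r) Bs"
  have IH: "\<forall>c. ?f c \<noteq> 0 \<longrightarrow> Suc r \<le> ?f c"
      "{c. ?f c \<noteq> 0} = (case Bs of [] \<Rightarrow> {} | X # _ \<Rightarrow> X)"
    using Cons.IH[of "Suc r"] Cons.prems by (auto simp: successively_Cons)
  have "{c. ?f c \<noteq> 0} \<subseteq> {1..n} \<and> card {c. ?f c \<noteq> 0} \<le> card X"
    unfolding IH(2) using Cons.prems by (cases Bs) auto
  then show ?case
    using label_row[of X n ?f r] IH(1) Cons.prems by simp
qed simp

lemma level_flow:
  assumes "in_cols n (X # Bs)" "shrinking (X # Bs)" "1 \<le> r" "r < k"
  shows "\<exists>p. flow n (level n (Suc r) Bs k) X (level n r (X # Bs) k) p"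
proof -
  let ?f = "fm_labels n (Suc r) Bs"
  have P: "\<forall>c. ?f c \<noteq> 0 \<longrightarrow> Suc r \<le> ?f c"
      "{c. ?f c \<noteq> 0} = (case Bs of [] \<Rightarrow> {} | X # _ \<Rightarrow> X)"
    using fm_labels_props[of Bs n "Suc r"] assms by (auto simp: successively_Cons)
  have "{c. ?f c \<noteq> 0} \<subseteq> {1..n} \<and> card {c. ?f c \<noteq> 0} \<le> card X"
    unfolding P(2) using assms by (cases Bs) auto
  then show ?thesis
    using label_row(3)[of X n ?f r k] P(1) assms by (simp add: level_def)
qed

lemma level_bottom:
  assumes "in_cols n (X # Bs)" "shrinking (X # Bs)" "1 \<le> r"
  shows "level n r (X # Bs) r = X"
proof -
  have "{c. fm_labels n r (X # Bs) c \<noteq> 0} = X"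
    "\<forall>c. fm_labels n r (X # Bs) c \<noteq> 0 \<longrightarrow> r \<le> fm_labels n r (X # Bs) c"
    using fm_labels_props[OF assms] by simp_all
  then show ?thesis using assms(3) unfolding level_def by fastforce
qed

lemma level_empty:
  assumes "in_cols n Bs" "shrinking Bs" "1 \<le> r" "r + length Bs \<le> k" "1 \<le> k"
  shows "level n r Bs k = {}"
  using assms
proof (induction Bs arbitrary: r)
  case (Cons X Bs)
  have "level n (Suc r) Bs k = {}" using Cons by (auto simp: successively_Cons)
  moreover obtain p where p: "flow n (level n (Suc r) Bs k) X (level n r (X # Bs) k) p"
    using level_flow[of X Bs n r k] Cons.prems by auto
  moreover have "flow n {} X {} (\<lambda>_. 0)" by (simp add: flow_def)
  ultimately show ?case using flow_unique Cons.prems(1) by (metis list.set_intros(1))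
qed (simp add: level_def)

text \<open>Moving along a string of the row crystal.\<close>

definition same_lowering :: "nat \<Rightarrow> nat set list \<Rightarrow> nat set list \<Rightarrow> bool" where
  "same_lowering n M M' \<longleftrightarrow> length M' = length M \<and> in_cols n M' \<and>
     (\<exists>i. Suc i < length M \<and> lower n i M = lower n i M')"

lemma same_lowering_Cons:
  assumes "(same_lowering n)\<^sup>*\<^sup>* M M'" "X \<subseteq> {1..n}"
  shows "(same_lowering n)\<^sup>*\<^sup>* (X # M) (X # M')"
  using assms(1)
proof (induction rule: rtranclp_induct)
  case (step M' M'')
  then obtain i where "length M'' = length M'" "in_cols n M''" "Suc i < length M'"
      "lower n i M' = lower n i M''"
    by (auto simp: same_lowering_def)
  then have "same_lowering n (X # M') (X # M'')"
    unfolding same_lowering_def using assms(2) by (auto intro!: exI[of _ "Suc i"])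
  then show ?case using step.IH by (rule rtranclp.rtrancl_into_rtrancl[rotated])
qed simp

lemma same_lowering_in_cols:
  "(same_lowering n)\<^sup>*\<^sup>* M M' \<Longrightarrow> in_cols n M \<Longrightarrow> in_cols n M' \<and> length M' = length M"
  by (induction rule: rtranclp_induct) (auto simp: same_lowering_def)

text \<open>For threshold \<open>k\<close> the level set starts as the whole of row \<open>k\<close>
  and is carried down row by row. Once it is the bottom row \<open>?A\<close> of the rows above
  \<open>X\<close>, the exchange of \<open>lower_reflect\<close> turns \<open>X, ?A\<close> into
  \<open>?S, ?A \<union> (X - ?S)\<close>, and \<open>?S\<close> is the level set one row
  lower.\<close>

lemma level_as_bottom_row:
  assumes "in_cols n Bs" "shrinking Bs" "1 \<le> r" "r \<le> k" "k < r + length Bs"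
  shows "\<exists>t. (same_lowering n)\<^sup>*\<^sup>* Bs (level n r Bs k # t)"
  using assms
proof (induction Bs arbitrary: r)
  case (Cons X Bs)
  show ?case
  proof (cases "k = r")
    case True
    then show ?thesis using level_bottom[OF Cons.prems(1-3)] by auto
  next
    case False
    let ?A = "level n (Suc r) Bs k" and ?S = "level n r (X # Bs) k"
    have X: "X \<subseteq> {1..n}" using Cons.prems by simp
    obtain t where t: "(same_lowering n)\<^sup>*\<^sup>* Bs (?A # t)"
      using Cons.IH[of "Suc r"] Cons.prems False by (auto simp: successively_Cons)
    then have ic: "in_cols n (?A # t)" using same_lowering_in_cols Cons.prems(1) by auto
    have "r < k" using Cons.prems(4) False by simp
    then obtain p where p: "flow n ?A X ?S p" using level_flow[OF Cons.prems(1-3)] by blast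
    let ?M = "?S # (?A \<union> (X - ?S)) # t"
    have "?S \<subseteq> X" using p by (simp add: flow_def)
    then have "in_cols n ?M" using X ic by auto
    then have "same_lowering n (X # ?A # t) ?M"
      unfolding same_lowering_def using lower_reflect[OF p X, of t] by (auto intro!: exI[of _ 0])
    then show ?thesis
      using same_lowering_Cons[OF t X] by (meson rtranclp.rtrancl_into_rtrancl)
  qed
qed simp

section \<open>The collapse, independently of the order of operators\<close>

definition collapses :: "nat \<Rightarrow> nat set list \<Rightarrow> nat set list \<Rightarrow> bool" where
  "collapses n M N \<longleftrightarrow> nonwrapping n N \<and>
     (\<exists>js. (\<forall>i \<in> set js. Suc i < length M) \<and> N = fold (lower n) js M)"

lemma collapses_unique:
  "in_cols n M \<Longrightarrow> collapses n M N \<Longrightarrow> collapses n M N' \<Longrightarrow> N = N'"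
  unfolding collapses_def using nonwrapping_unique by blast

lemma foldr_e_down_star:
  "\<forall>i \<in> set js. Suc i < length N \<Longrightarrow>
    foldr (e_down_star n) (map Suc js) N = fold (lower n) (rev js) N"
proof (induction js)
  case (Cons i js)
  then show ?case by (simp add: e_down_star_eq_lower)
qed simp

lemma e_down_star_upto_eq:
  assumes "b < length N"
  shows "e_down_star_upto n b N = fold (lower n) (rev [0..<b]) N"
    and "e_down_star_upto n b N = push n (take (Suc b) N) @ drop (Suc b) N"
proof -
  have "[1..<Suc b] = map Suc [0..<b]" by (simp add: map_Suc_upt del: upt_Suc)
  then show e: "e_down_star_upto n b N = fold (lower n) (rev [0..<b]) N"
    unfolding e_down_star_upto_def using foldr_e_down_star[of "[0..<b]" N n] assms
    by (simp del: upt_Suc)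
  have "foldr (lower n) [0..<length (take (Suc b) N) - 1] (take (Suc b) N @ drop (Suc b) N)
    = push n (take (Suc b) N) @ drop (Suc b) N"
    by (rule foldr_lower_eq_push) (use assms in auto)
  moreover have "length (take (Suc b) N) - 1 = b" using assms by simp
  ultimately show "e_down_star_upto n b N = push n (take (Suc b) N) @ drop (Suc b) N"
    using e by (simp add: foldr_conv_fold)
qed

text \<open>After \<open>b\<close> rounds the lowest \<open>Suc b\<close> rows are nonwrapping,
  since each round pushes one further row into a nonwrapping tuple.\<close>

lemma collapses_collapse: "collapses n M (collapse n M)"
proof (cases "M = []")
  case True
  then show ?thesis by (auto simp: collapses_def collapse_def intro!: exI[of _ "[]"])
next
  case False
  have "\<exists>js. (\<forall>i \<in> set js. Suc i < length M) \<and>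
      fold (e_down_star_upto n) [1..<Suc b] M = fold (lower n) js M \<and>
      nonwrapping n (take (Suc b) (fold (lower n) js M))"
    if "b < length M" for b
    using that
  proof (induction b)
    case 0
    obtain X r where "M = X # r" using False by (cases M) auto
    then show ?case by (intro exI[of _ "[]"]) simp
  next
    case (Suc b)
    then obtain js where js: "\<forall>i \<in> set js. Suc i < length M"
        "fold (e_down_star_upto n) [1..<Suc b] M = fold (lower n) js M"
        "nonwrapping n (take (Suc b) (fold (lower n) js M))" by auto
    let ?N = "fold (lower n) js M"
    have l: "Suc b < length ?N" using Suc by simp
    have "fold (e_down_star_upto n) [1..<Suc (Suc b)] M = e_down_star_upto n (Suc b) ?N"
      using js(2) by simp
    also have "\<dots> = fold (lower n) (js @ rev [0..<Suc b]) M"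
      using e_down_star_upto_eq(1)[OF l] by simp
    finally have e: "fold (e_down_star_upto n) [1..<Suc (Suc b)] M
      = fold (lower n) (js @ rev [0..<Suc b]) M" .
    have "take (Suc (Suc b)) ?N = take (Suc b) ?N @ [?N ! Suc b]"
      using l by (simp add: take_Suc_conv_app_nth)
    then have "nonwrapping n (push n (take (Suc (Suc b)) ?N))" using nonwrapping_push[OF js(3)] by simp
    moreover have "take (Suc (Suc b)) (e_down_star_upto n (Suc b) ?N)
      = push n (take (Suc (Suc b)) ?N)"
      unfolding e_down_star_upto_eq(2)[OF l] using l by simp
    moreover have "\<forall>i \<in> set (js @ rev [0..<Suc b]). Suc i < length M" using js(1) Suc by auto
    ultimately show ?case
      using e e_down_star_upto_eq(1)[OF l] by (intro exI[of _ "js @ rev [0..<Suc b]"]) simp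
  qed
  from this[of "length M - 1"] show ?thesis
    using False unfolding collapses_def collapse_def by (auto simp del: upt_Suc)
qed

text \<open>Two tuples with a common image under a lowering operator can both be continued to the
  collapse of that image; uniqueness identifies it with \<open>N\<close>.\<close>

lemma collapses_same_lowering:
  assumes "(same_lowering n)\<^sup>*\<^sup>* M M'" "in_cols n M" "collapses n M' N"
  shows "collapses n M N"
  using assms(1,3)
proof (induction arbitrary: N rule: rtranclp_induct)
  case (step M' M'')
  obtain i where i: "length M'' = length M'" "in_cols n M''" "Suc i < length M'"
      "lower n i M' = lower n i M''"
    using step.hyps(2) by (auto simp: same_lowering_def)
  let ?N = "collapse n (lower n i M')"
  obtain js where js: "nonwrapping n ?N" "\<forall>i \<in> set js. Suc i < length M'"
      "?N = fold (lower n) js (lower n i M')"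
    using collapses_collapse[of n "lower n i M'"] by (auto simp: collapses_def)
  have "?N = fold (lower n) (i # js) M'" "?N = fold (lower n) (i # js) M''"
    using js(3) i(4) by simp_all
  moreover have "\<forall>i \<in> set (i # js). Suc i < length M'" using js i by simp
  ultimately have "collapses n M' ?N" "collapses n M'' ?N"
    unfolding collapses_def using js(1) i(1) by metis+
  then show ?case using step.IH collapses_unique[OF i(2) step.prems] by metis
qed simp

text \<open>Treats the bottom row last, while \<open>collapse\<close> works upwards from the bottom
  rows. Uniqueness makes the two results agree, and in this order the set inserted below is visible
  in the result.\<close>

lemma collapses_Cons:
  assumes "collapses n M N"
  shows "collapses n (B # M) (ins n B N)"
proof -
  obtain js where js: "nonwrapping n N" "\<forall>i \<in> set js. Suc i < length M" "N = fold (lower n) js M"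
    using assms by (auto simp: collapses_def)
  have "length N = length M" using js(3) by simp
  then have "ins n B N = fold (lower n) (map Suc js @ [0..<length N]) (B # M)"
    using fold_lower_eq_ins[of n N B] js(3) by (simp add: fold_lower_Suc)
  moreover have "\<forall>i \<in> set (map Suc js @ [0..<length N]). Suc i < length (B # M)"
    using js(2) \<open>length N = length M\<close> by auto
  ultimately show ?thesis unfolding collapses_def using nonwrapping_ins[OF js(1)] by blast
qed

section \<open>Level sets after the insertion of a bottom row\<close>

lemma nonwrapping_shrinking: "in_cols n N \<Longrightarrow> nonwrapping n N \<Longrightarrow> shrinking N"
proof (induction N rule: induct_list012)
  case (3 X Y N)
  have "suf n Z 1 = card Z" if "Z \<subseteq> {1..n}" for Z
    using that by (simp add: suf_def Int_absorb2)
  then show ?case using 3 by (force simp: dominates_def)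
qed simp_all

lemma in_cols_ins: "in_cols n N \<Longrightarrow> B \<subseteq> {1..n} \<Longrightarrow> in_cols n (ins n B N)"
proof (induction N arbitrary: B)
  case (Cons Y N)
  have Y: "Y \<subseteq> {1..n}" "in_cols n N" using Cons.prems(1) by simp_all
  then have "Y - unmatched n B Y \<subseteq> {1..n}" by blast
  then have "in_cols n (ins n (Y - unmatched n B Y) N)" by (rule Cons.IH[OF Y(2)])
  moreover have "B \<union> unmatched n B Y \<subseteq> {1..n}" using Cons.prems(2) Y(1) unmatched_subset[of n B Y] by blast
  ultimately show ?case by simp
qed simp

text \<open>Let \<open>u < j\<close> be the last ball moved down left of \<open>j\<close>. All bottom balls in columns \<open>u + 1, \<dots>, j\<close> are
  matched by balls of the second row in these columns, so a level set of the upper rows containing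
  all of the latter hits \<open>j\<close>; no ball of it that comes from the left of \<open>u\<close> reaches a moved ball.\<close>

lemma ins_levels:
  assumes "in_cols n Ns" "nonwrapping n Ns" "B \<subseteq> {1..n}" "1 \<le> r" "j \<in> B"
  shows "\<exists>k \<ge> r. j \<in> level n r (ins n B Ns) k \<and> level n r (ins n B Ns) k \<inter> {1..<j} \<subseteq> B"
  using assms
proof (induction Ns arbitrary: B r j)
  case Nil
  then have "level n r [B] r = B" by (intro level_bottom) auto
  then show ?case using Nil by (intro exI[of _ r]) auto
next
  case (Cons Y Ns)
  let ?U = "unmatched n B Y" and ?N = "ins n B (Y # Ns)"
  let ?T = "ins n (Y - ?U) Ns"
  have Ysub: "Y \<subseteq> {1..n}" using Cons.prems by simp
  have N: "?N = (B \<union> ?U) # ?T" by simp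
  have icN: "in_cols n ?N" by (rule in_cols_ins) (use Cons.prems in auto)
  have hwN: "nonwrapping n ?N" by (rule nonwrapping_ins) (use Cons.prems in auto)
  have shN: "shrinking ?N" using nonwrapping_shrinking icN hwN by blast
  have bot: "level n r ?N r = B \<union> ?U" 
    unfolding N by (rule level_bottom[OF icN[unfolded N] shN[unfolded N] Cons.prems(4)])
  show ?case
  proof (cases "?U \<inter> {1..<j} = {}")
    case True
    then show ?thesis using bot Cons.prems(5) by (intro exI[of _ r]) auto
  next
    case False
    define u where "u = Max (?U \<inter> {1..<j})"
    have "u \<in> ?U \<inter> {1..<j}" unfolding u_def using False by (intro Max_in) auto
    then have u: "u \<in> ?U" "1 \<le> u" "u < j" by auto
    have umax: "e \<le> u" if "e \<in> ?U" "e < j" for e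
      unfolding u_def using that by (intro Max_ge) (auto simp: unmatched_def)
    have j: "j \<notin> ?U" "j \<le> n" using Cons.prems(3,5) by (auto simp: unmatched_def)
    have uB: "u \<notin> B" "u \<in> Y" using u by (auto simp: unmatched_def)
    define X where "X = (Y - ?U) \<inter> {Suc u..j}"
    have noU: "?U \<inter> {Suc u..j} = {}"
    proof (rule ccontr)
      assume "?U \<inter> {Suc u..j} \<noteq> {}"
      then obtain e where e: "e \<in> ?U" "Suc u \<le> e" "e \<le> j" by auto
      then have "e < j" using j(1) by (cases "e = j") auto
      then show False using umax[OF e(1)] e(2) by simp
    qed
    have XY: "X = Y \<inter> {Suc u..j}" unfolding X_def using noU by blast
    \<comment> \<open>That \<open>u\<close> is unmatched, tested on \<open>{u..j}\<close>. Dropping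
      \<open>u\<close>, which lies in \<open>Y\<close> but not in \<open>B\<close>, makes the
      inequality weak.\<close>
    have "suf j B u < suf j Y u" using u j unmatched_iff[of u n B Y] by auto
    then have BY: "suf j B (Suc u) \<le> suf j Y (Suc u)"
      using suf_step[of u j B] suf_step[of u j Y] uB u by simp
    moreover have "0 < suf j B (Suc u)"
      using Cons.prems(5) u by (auto simp: suf_def card_gt_0_iff)
    ultimately have "X \<noteq> {}" unfolding XY suf_def by (metis card.empty less_le_trans less_irrefl)
    have "\<forall>y \<in> X. \<exists>k \<ge> Suc r. y \<in> level n (Suc r) ?T k \<and> level n (Suc r) ?T k \<inter> {1..<y} \<subseteq> Y - ?U"
    proof
      fix y assume "y \<in> X"
      then show "\<exists>k \<ge> Suc r. y \<in> level n (Suc r) ?T k \<and> level n (Suc r) ?T k \<inter> {1..<y} \<subseteq> Y - ?U"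
        using Cons.prems by (intro Cons.IH) (auto simp: X_def successively_Cons)
    qed
    then obtain \<kappa> where \<kappa>: "\<And>y. y \<in> X \<Longrightarrow> Suc r \<le> \<kappa> y"
        "\<And>y. y \<in> X \<Longrightarrow> y \<in> level n (Suc r) ?T (\<kappa> y)"
        "\<And>y. y \<in> X \<Longrightarrow> level n (Suc r) ?T (\<kappa> y) \<inter> {1..<y} \<subseteq> Y - ?U"
      by metis
    \<comment> \<open>Level sets shrink as the threshold grows, so the least threshold yields one
      containing all of \<open>X\<close>. The column \<open>y\<close> where it is attained lies
      right of \<open>u\<close> and so controls this level set up to \<open>u\<close>.\<close>
    define k where "k = Min (\<kappa> ` X)"
    have fX: "finite (\<kappa> ` X)" by (simp add: X_def)
    then have "k \<in> \<kappa> ` X" unfolding k_def using \<open>X \<noteq> {}\<close> by (intro Min_in) auto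
    then obtain y where y: "y \<in> X" "k = \<kappa> y" by blast
    have k: "Suc r \<le> k" using \<kappa>(1) y by simp
    let ?E = "level n (Suc r) ?T k" and ?S = "level n r ?N k"
    have XE: "X \<subseteq> ?E"
    proof
      fix x assume x: "x \<in> X"
      then have "k \<le> \<kappa> x" unfolding k_def using fX by simp
      then show "x \<in> ?E" using \<kappa>(2)[OF x] level_antimono by blast
    qed
    have Elow: "?E \<inter> {1..u} \<subseteq> Y - ?U"
    proof -
      have "{1..u} \<subseteq> {1..<y}" using y(1) by (auto simp: X_def)
      then show ?thesis using \<kappa>(3)[OF y(1)] y(2) by blast
    qed
    have flowS: "\<exists>p. flow n ?E (B \<union> ?U) ?S p"
      unfolding N by (rule level_flow[OF icN[unfolded N] shN[unfolded N] Cons.prems(4)]) (use k in simp)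
    obtain T0 T1 where T: "?T = T0 # T1" by (cases Ns) auto
    have ET: "?E \<subseteq> T0"
    proof -
      have "level n (Suc r) ?T (Suc r) = T0"
        unfolding T by (rule level_bottom) (use icN shN in \<open>simp_all add: T\<close>)
      then show ?thesis using level_antimono[OF k] by blast
    qed
    \<comment> \<open>Dominance supplies a flow without wrapping, and \<open>flow_unique\<close>
      shows that it pairs the same set \<open>?S\<close> as the labelling.\<close>
    have "dominates n (B \<union> ?U) T0" using hwN by (simp add: T)
    then have "dominates n (B \<union> ?U) ?E" by (rule dominates_mono[OF _ subset_refl ET])
    then obtain S' p where Sp: "flow n ?E (B \<union> ?U) S' p" "p 0 = 0" using flow_nonwrapping by blast
    have "S' = ?S" using flow_unique[OF Sp(1)] flowS icN unfolding N by auto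
    then have p: "flow n ?E (B \<union> ?U) ?S p" using Sp by simp
    have SB: "?S \<subseteq> B \<union> ?U" using p by (simp add: flow_def)
    \<comment> \<open>If \<open>j\<close> were missed, the flow would vanish at \<open>j\<close>.
      Counting in \<open>{Suc u..j}\<close> then gives at least as many balls in \<open>?S\<close>
      as in \<open>?E\<close>, fewer in \<open>?S\<close> than in \<open>B\<close>, and no more in
      \<open>B\<close> than in \<open>Y\<close>, all of whose balls there lie in
      \<open>?E\<close>.\<close>
    have "j \<in> ?S"
    proof (rule ccontr)
      assume nj: "j \<notin> ?S"
      obtain j' where j': "j = Suc j'" using u(3) by (cases j) auto
      have "p j = 0" using flow_unpaired(1)[OF p, of j'] j' j(2) nj Cons.prems(5) by simp
      then have "suf j ?E (Suc u) \<le> suf j ?S (Suc u)"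
        using flow_interval[OF p, of u j] u j by simp
      moreover have "suf j ?S (Suc u) < suf j B (Suc u)"
        unfolding suf_def
      proof (rule psubset_card_mono)
        show "?S \<inter> {Suc u..j} \<subset> B \<inter> {Suc u..j}"
          using SB noU nj Cons.prems(5) u by auto
      qed simp
      moreover have "suf j Y (Suc u) \<le> suf j ?E (Suc u)"
        unfolding suf_def using XE XY by (intro card_mono) auto
      ultimately show False using BY by simp
    qed
    moreover have "?S \<inter> {1..<j} \<subseteq> B"
    proof (rule ccontr)
      assume "\<not> ?S \<inter> {1..<j} \<subseteq> B"
      then obtain e where e: "e \<in> ?S" "1 \<le> e" "e < j" "e \<in> ?U" using SB by fastforce
      obtain e' where e': "e = Suc e'" using e(2) by (cases e) auto
      have eu: "e \<le> u" using umax e by simp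
      have en: "e' < n" using e' e(3) j(2) by simp
      have "e \<notin> ?E" using Elow eu e by auto
      \<comment> \<open>A ball of \<open>?E\<close> would have to reach \<open>e\<close> from the
        left, so the busy period from \<open>x\<close> to \<open>e'\<close> holds more balls of
        \<open>?E\<close> than of \<open>B\<close>. But there \<open>?E\<close> lies in
        \<open>Y - ?U\<close>, which has at most as many balls as \<open>B\<close>, because nothing
        is pending just left of the unmatched ball \<open>e\<close>.\<close>
      then have "0 < p e'" using flow_step[OF p en] e(1) e' by simp
      then obtain x where x: "1 \<le> x" "x \<le> e'" "suf e' ?E x = p e' + suf e' (B \<union> ?U) x"
        using flow_positive[OF p Sp(2), of e'] en by auto
      have "suf e' ?E x \<le> suf e' (Y - ?U) x"
        unfolding suf_def using Elow eu e' x(1) by (intro card_mono) auto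
      moreover have "suf e' B x \<le> suf e' (B \<union> ?U) x" by (rule suf_mono) simp
      moreover have "suf e' (Y - ?U) x \<le> suf e' B x"
      proof -
        have split: "suf n Z x = suf e' Z x + suf n Z (Suc e')" for Z
        proof -
          have "{x..n} = {x..e'} \<union> {Suc e'..n}" using x en by auto
          then have "Z \<inter> {x..n} = (Z \<inter> {x..e'}) \<union> (Z \<inter> {Suc e'..n})" by blast
          then show ?thesis unfolding suf_def by (simp add: card_Un_disjoint disjoint_iff)
        qed
        have "pend n B Y e' = 0"
          using pend_step[OF en, of B Y] e(4) e' by (auto simp: unmatched_def)
        then have "suf n (Y - ?U) (Suc e') = suf n B (Suc e')" using pend_suf[of e' n B Y] en by simp
        then show ?thesis using suf_diff_unmatched_le[OF x(1), of n Y B] split[of B] split[of "Y - ?U"] by simp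
      qed
      ultimately show False using x(3) \<open>0 < p e'\<close> by simp
    qed
    ultimately show ?thesis using k by (intro exI[of _ k]) auto
  qed
qed

lemma mlq_shrinking:
  assumes "is_mlq n lam M"
  shows "in_cols n M" "shrinking M"
proof -
  have M: "M ! i \<subseteq> {1..n} \<and> card (M ! i) = conj_part lam (Suc i)" if "i < length M" for i
  proof -
    have "Suc i \<in> {1..length M}" using that by simp
    then show ?thesis using assms unfolding is_mlq_def row_def by fastforce
  qed
  then show "in_cols n M" by (metis in_set_conv_nth)
  have "conj_part lam (Suc r) \<le> conj_part lam r" for r
    unfolding conj_part_def by (intro card_mono) auto
  then show "shrinking M" using M by (auto simp: successively_conv_nth)
qed

lemma collapse_levels:
  assumes "in_cols n M" "shrinking M" "1 \<le> k" "j \<in> level n 1 M k"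
  shows "\<exists>k' \<ge> 1. j \<in> level n 1 (collapse n M) k' \<and>
    level n 1 (collapse n M) k' \<inter> {1..<j} \<subseteq> level n 1 M k"
proof -
  let ?B = "level n 1 M k"
  have "k < 1 + length M"
  proof (rule ccontr)
    assume "\<not> k < 1 + length M"
    then have "?B = {}" using assms by (intro level_empty) auto
    then show False using assms(4) by simp
  qed
  then obtain t where t: "(same_lowering n)\<^sup>*\<^sup>* M (?B # t)"
    using level_as_bottom_row[OF assms(1,2), of 1 k] assms(3) by auto
  have ic: "in_cols n (?B # t)" using same_lowering_in_cols[OF t assms(1)] by simp
  let ?N = "collapse n t"
  have cN: "collapses n t ?N" by (rule collapses_collapse)
  then have "collapses n M (ins n ?B ?N)"
    using collapses_same_lowering[OF t assms(1)] collapses_Cons by blast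
  then have e: "collapse n M = ins n ?B ?N"
    using collapses_unique[OF assms(1) collapses_collapse] by blast
  obtain js where js: "nonwrapping n ?N" "\<forall>i \<in> set js. Suc i < length t" "?N = fold (lower n) js t"
    using cN by (auto simp: collapses_def)
  then have "in_cols n ?N" using in_cols_fold_lower[of t n js] ic by simp
  then show ?thesis unfolding e using ic js(1) assms(4) by (intro ins_levels) auto
qed

theorem theorem3p26:
  fixes n :: nat and lam :: "nat list" and M :: "nat set list" and i j :: nat
    and \<alpha> \<beta> :: "nat list"
  assumes "is_partition lam"
    and "length lam < n"
    and "is_mlq n lam M"
    and "\<alpha> = mlq_type n M"
    and "\<beta> = mlq_type n (collapse n M)"
    and "1 \<le> i" and "i < j" and "j \<le> n"
    and "\<alpha> ! (i - 1) < \<alpha> ! (j - 1)"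
  shows "\<beta> ! (i - 1) < \<beta> ! (j - 1)"
proof -
  have type: "mlq_type n N ! (c - 1) = fm_labels n 1 N c" if "1 \<le> c" "c \<le> n" for N c
    using that by (simp add: mlq_type_def del: upt_Suc)
  \<comment> \<open>The threshold that separates the two columns: \<open>j\<close> belongs to this
    level set of \<open>M\<close>, and \<open>i\<close> does not.\<close>
  let ?k = "fm_labels n 1 M j"
  have lt: "fm_labels n 1 M i < ?k" using assms type[of i M] type[of j M] by simp
  then obtain k' where k': "k' \<ge> 1" "j \<in> level n 1 (collapse n M) k'"
      "level n 1 (collapse n M) k' \<inter> {1..<j} \<subseteq> level n 1 M ?k"
    using collapse_levels[OF mlq_shrinking[OF assms(3)], of ?k j] by (auto simp: level_def)
  have "i \<notin> level n 1 M ?k" using lt by (simp add: level_def)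
  then have "i \<notin> level n 1 (collapse n M) k'" using k'(3) assms by auto
  then have "fm_labels n 1 (collapse n M) i < fm_labels n 1 (collapse n M) j"
    using k'(2) by (simp add: level_def)
  then show ?thesis using assms type[of i] type[of j] by simp
qed

end
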